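(* (1) The cliff set statistic $\mathrm{Cliff}$ is shuffle-compatible on words. (2) The linear map on $\mathcal{A}^{W}_{\mathrm{Cliff}}$ defined by $[\alpha]^W_{\mathrm{Cliff}}\mapsto K_{|\alpha|,\mathrm{Cliff}(\alpha)}$ is an algebra isomorphism from $\mathcal{A}^{W}_{\mathrm{Cliff}}$ to Stembridge's algebra of peaks $\mathbf{\Pi}$.
   Context: All algebras are over $\mathbb{Q}$. A word of length $n\ge0$ is a sequence $\alpha=(\alpha_1,\dots,\alpha_n)$ of positive integers; $|\alpha|=n$; $W$ is the set of all words. If the distinct letters of $\alpha$ are $a_1<\dots<a_k$, then $\mathrm{pack}(\alpha)$ is obtained by replacing each $a_i$ by $i$. Two words are disjoint if they have no common letter. $\mathrm{Sh}(\alpha,\beta)$ is the multiset of all $\binom{|\alpha|+|\beta|}{|\alpha|}$ interleavings (shuffles) of $\alpha$ and $\beta$. The cliff set is $\mathrm{Cliff}(\alpha)=\{i: 2\le i\le n-1,\ \alpha_{i-1}\le\alpha_i>\alpha_{i+1}\}$. A statistic $\mathrm{st}$ (function on $W$) is shuffle-compatible on words if (i) for all disjoint words $\alpha,\beta$ the multiset $\{\{\mathrm{st}(\gamma):\gamma\in \mathrm{Sh}(\alpha,\beta)\}\}$ is determined by $|\alpha|,|\beta|,\mathrm{st}(\alpha),\mathrm{st}(\beta)$; and (ii) $\mathrm{pack}(\alpha)=\mathrm{pack}(\beta)$ implies $\mathrm{st}(\alpha)=\mathrm{st}(\beta)$. Let $[\alpha]^W_{\mathrm{st}}=\{\beta\in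 W:\mathrm{st}(\beta)=\mathrm{st}(\alpha),|\beta|=|\alpha|\}$. $\mathcal{A}^W_{\mathrm{st}}$ is the algebra with basis these classes and product $[\alpha]^W_{\mathrm{st}}[\beta]^W_{\mathrm{st}}=\sum_{\gamma\in \mathrm{Sh}(\alpha,\beta)}[\gamma]^W_{\mathrm{st}}$, for disjoint representatives $\alpha,\beta$. $\mathbf{\Pi}$ is the subalgebra of the algebra $\mathrm{QSym}$ of quasisymmetric functions spanned by the (linearly independent) peak quasisymmetric functions $K_{n,S}$, where $n\ge 0$ and $S$ is the peak set $\mathrm{Peak}(\pi)=\{i:2\le i\le n-1,\ \pi_{i-1}<\pi_i>\pi_{i+1}\}$ of some permutation $\pi$ of length $n$ (a sequence of $n$ distinct positive integers). Explicitly (Stembridge), $K_{0,\emptyset}=1$ and for $n\ge1$, $K_{n,S}=2^{|S|+1}\sum_{D}F_{n,D}$, the sum over $D\subseteq[n-1]$ with $S\subseteq D\,\triangle\,(D+1)$, where $D+1=\{d+1:d\in D\}$, $\triangle$ is symmetric difference, and $F_{n,D}=\sum x_{i_1}\cdots x_{i_n}$ over $i_1\le\dots\le i_n$ with $i_j<i_{j+1}$ for $j\in D$. Their product is $K_{m,\mathrm{Peak}(\tau)}K_{n,\mathrm{Peak}(\theta)}=\sum_{\pi\in \mathrm{Sh}(\tau,\theta)}K_{m+n,\mathrm{Peak}(\pi)}$ for disjoint permutations $\tau,\theta$ of lengths $m,n$. *)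

theory Defs
  imports "HOL-Algebra.Algebra" "HOL-Algebra.Algebraic_Closure_Type" "HOL-Library.Multiset" "HOL-Library.Poly_Mapping"
begin

section \<open>Words, statistics and shuffle-compatibility\<close>

definition words :: "nat list set" where
  "words = {\<alpha>. \<forall>a\<in>set \<alpha>. 0 < a}"

definition pack :: "nat list \<Rightarrow> nat list" where
  "pack \<alpha> = map (\<lambda>a. card {b \<in> set \<alpha>. b \<le> a}) \<alpha>"

definition disjoint_words :: "nat list \<Rightarrow> nat list \<Rightarrow> bool" where
  "disjoint_words \<alpha> \<beta> \<longleftrightarrow> set \<alpha> \<inter> set \<beta> = {}"

text \<open>The library's \<^const>\<open>shuffles\<close> is the underlying set of this multiset.\<close>

fun Sh :: "'a list \<Rightarrow> 'a list \<Rightarrow> 'a list multiset" where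
  "Sh [] \<beta> = {#\<beta>#}"
| "Sh \<alpha> [] = {#\<alpha>#}"
| "Sh (a # \<alpha>) (b # \<beta>) =
     image_mset ((#) a) (Sh \<alpha> (b # \<beta>)) + image_mset ((#) b) (Sh (a # \<alpha>) \<beta>)"

lemma set_mset_Sh: "set_mset (Sh \<alpha> \<beta>) = shuffles \<alpha> \<beta>"
  by (induction \<alpha> \<beta> rule: Sh.induct) auto

lemma size_Sh: "size (Sh \<alpha> \<beta>) = (length \<alpha> + length \<beta>) choose length \<alpha>"
  by (induction \<alpha> \<beta> rule: Sh.induct) (auto simp: add.commute)

definition shuffle_compatible_on_words :: "(nat list \<Rightarrow> 'a) \<Rightarrow> bool" where
  "shuffle_compatible_on_words st \<longleftrightarrow>
     (\<forall>\<alpha>\<in>words. \<forall>\<beta>\<in>words. \<forall>\<alpha>'\<in>words. \<forall>\<beta>'\<in>words.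
        disjoint_words \<alpha> \<beta> \<and> disjoint_words \<alpha>' \<beta>' \<and>
        length \<alpha> = length \<alpha>' \<and> length \<beta> = length \<beta>' \<and> st \<alpha> = st \<alpha>' \<and> st \<beta> = st \<beta>' \<longrightarrow>
        image_mset st (Sh \<alpha> \<beta>) = image_mset st (Sh \<alpha>' \<beta>')) \<and>
     (\<forall>\<alpha>\<in>words. \<forall>\<beta>\<in>words. pack \<alpha> = pack \<beta> \<longrightarrow> st \<alpha> = st \<beta>)"

text \<open>Positions are counted from 1, so the \<open>i\<close>-th letter of \<open>\<alpha>\<close> is \<open>\<alpha> ! (i - 1)\<close>.\<close>

definition Cliff :: "nat list \<Rightarrow> nat set" where
  "Cliff \<alpha> = {i. 2 \<le> i \<and> i \<le> length \<alpha> - 1 \<and>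
     \<alpha> ! (i - 2) \<le> \<alpha> ! (i - 1) \<and> \<alpha> ! (i - 1) > \<alpha> ! i}"

definition Peak :: "nat list \<Rightarrow> nat set" where
  "Peak \<pi> = {i. 2 \<le> i \<and> i \<le> length \<pi> - 1 \<and>
     \<pi> ! (i - 2) < \<pi> ! (i - 1) \<and> \<pi> ! (i - 1) > \<pi> ! i}"

section \<open>The shuffle algebra of a statistic\<close>

abbreviation rat_ring :: "rat ring" where
  "rat_ring \<equiv> ring_of_type_algebra"

definition wclass :: "(nat list \<Rightarrow> 'a) \<Rightarrow> nat list \<Rightarrow> nat list set" where
  "wclass st \<alpha> = {\<beta> \<in> words. st \<beta> = st \<alpha> \<and> length \<beta> = length \<alpha>}"

definition basis_elem :: "(nat list \<Rightarrow> 'a) \<Rightarrow> nat list \<Rightarrow> nat list set \<Rightarrow>\<^sub>0 rat" where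
  "basis_elem st \<alpha> = Poly_Mapping.single (wclass st \<alpha>) 1"

text \<open>The product of two classes is formed from chosen disjoint representatives; the lemma
  \<open>class_mult_eq\<close> below shows that for a shuffle-compatible statistic the choice is
  immaterial, and \<open>ex_disjoint_representative\<close> that one can always choose.\<close>

definition class_mult ::
    "(nat list \<Rightarrow> 'a) \<Rightarrow> nat list set \<Rightarrow> nat list set \<Rightarrow> nat list set \<Rightarrow>\<^sub>0 rat" where
  "class_mult st C D =
     (let (\<alpha>, \<beta>) = (SOME (\<alpha>, \<beta>). \<alpha> \<in> C \<and> \<beta> \<in> D \<and> disjoint_words \<alpha> \<beta>)
      in \<Sum>\<gamma>\<in>#Sh \<alpha> \<beta>. basis_elem st \<gamma>)"

definition scale :: "rat \<Rightarrow> ('b \<Rightarrow>\<^sub>0 rat) \<Rightarrow> ('b \<Rightarrow>\<^sub>0 rat)" where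
  "scale c f = Poly_Mapping.map ((*) c) f"

definition word_algebra :: "(nat list \<Rightarrow> 'a) \<Rightarrow> (rat, nat list set \<Rightarrow>\<^sub>0 rat) module" where
  "word_algebra st =
     \<lparr>carrier = {f. Poly_Mapping.keys f \<subseteq> wclass st ` words},
      monoid.mult = (\<lambda>f g. \<Sum>C\<in>Poly_Mapping.keys f. \<Sum>D\<in>Poly_Mapping.keys g.
                scale (Poly_Mapping.lookup f C * Poly_Mapping.lookup g D) (class_mult st C D)),
      one = basis_elem st [],
      ring.zero = 0,
      add = (+),
      module.smult = scale\<rparr>"

lemma Sh_words: "\<alpha> \<in> words \<Longrightarrow> \<beta> \<in> words \<Longrightarrow> \<gamma> \<in># Sh \<alpha> \<beta> \<Longrightarrow> \<gamma> \<in> words"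
  by (auto simp: set_mset_Sh words_def set_shuffles)

lemma length_Sh: "\<gamma> \<in># Sh \<alpha> \<beta> \<Longrightarrow> length \<gamma> = length \<alpha> + length \<beta>"
  by (auto simp: set_mset_Sh length_shuffles)

lemma class_mult_eq:
  assumes st: "shuffle_compatible_on_words st"
    and w: "\<alpha> \<in> words" "\<beta> \<in> words" and dj: "disjoint_words \<alpha> \<beta>"
  shows "class_mult st (wclass st \<alpha>) (wclass st \<beta>) = (\<Sum>\<gamma>\<in>#Sh \<alpha> \<beta>. basis_elem st \<gamma>)"
proof -
  define P where "P = (\<lambda>(\<alpha>', \<beta>'). \<alpha>' \<in> wclass st \<alpha> \<and> \<beta>' \<in> wclass st \<beta> \<and> disjoint_words \<alpha>' \<beta>')"
  obtain \<alpha>' \<beta>' where ab: "(SOME p. P p) = (\<alpha>', \<beta>')"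
    by fastforce
  have "P (\<alpha>, \<beta>)"
    using w dj by (simp add: P_def wclass_def)
  then have "P (\<alpha>', \<beta>')"
    using someI[of P] ab by metis
  then have *: "\<alpha>' \<in> words" "\<beta>' \<in> words" "disjoint_words \<alpha>' \<beta>'" "length \<alpha>' = length \<alpha>"
      "length \<beta>' = length \<beta>" "st \<alpha>' = st \<alpha>" "st \<beta>' = st \<beta>"
    by (auto simp: P_def wclass_def)
  then have eq: "image_mset st (Sh \<alpha>' \<beta>') = image_mset st (Sh \<alpha> \<beta>)"
    using st w dj unfolding shuffle_compatible_on_words_def by blast
  define h where "h = (\<lambda>s. Poly_Mapping.single
    {\<delta> \<in> words. st \<delta> = s \<and> length \<delta> = length \<alpha> + length \<beta>} (1::rat))"
  have "image_mset (basis_elem st) (Sh \<alpha>' \<beta>') = image_mset h (image_mset st (Sh \<alpha>' \<beta>'))"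
    using * by (auto simp: multiset.map_comp h_def basis_elem_def wclass_def length_Sh
        intro!: image_mset_cong)
  moreover have "image_mset (basis_elem st) (Sh \<alpha> \<beta>) = image_mset h (image_mset st (Sh \<alpha> \<beta>))"
    by (auto simp: multiset.map_comp h_def basis_elem_def wclass_def length_Sh
        intro!: image_mset_cong)
  ultimately have "image_mset (basis_elem st) (Sh \<alpha>' \<beta>') = image_mset (basis_elem st) (Sh \<alpha> \<beta>)"
    using eq by simp
  moreover have "class_mult st (wclass st \<alpha>) (wclass st \<beta>) = (\<Sum>\<gamma>\<in>#Sh \<alpha>' \<beta>'. basis_elem st \<gamma>)"
    using ab by (simp add: class_mult_def P_def)
  ultimately show ?thesis by simp
qed

lemma ex_disjoint_representative:
  assumes st: "shuffle_compatible_on_words st" and w: "\<alpha> \<in> words" "\<beta> \<in> words"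
  shows "\<exists>\<beta>'\<in>wclass st \<beta>. disjoint_words \<alpha> \<beta>'"
proof -
  define N where "N = Suc (sum_list \<alpha>)"
  define \<beta>' where "\<beta>' = map ((+) N) \<beta>"
  have "{b \<in> (+) N ` set \<beta>. b \<le> N + a} = (+) N ` {b \<in> set \<beta>. b \<le> a}" for a
    by auto
  then have "pack \<beta>' = pack \<beta>"
    by (auto simp: pack_def \<beta>'_def card_image inj_on_def)
  moreover have "\<beta>' \<in> words"
    by (auto simp: \<beta>'_def words_def N_def)
  ultimately have "\<beta>' \<in> wclass st \<beta>"
  proof -
    assume "pack \<beta>' = pack \<beta>" "\<beta>' \<in> words"
    then have "st \<beta>' = st \<beta>"
      using st w unfolding shuffle_compatible_on_words_def by blast
    with \<open>\<beta>' \<in> words\<close> show ?thesis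
      by (simp add: wclass_def \<beta>'_def)
  qed
  moreover have "a < N" if "a \<in> set \<alpha>" for a
    using member_le_sum_list[OF that] by (simp add: N_def)
  then have "disjoint_words \<alpha> \<beta>'"
    by (fastforce simp: disjoint_words_def \<beta>'_def)
  ultimately show ?thesis by blast
qed

lemma scale_one: "scale 1 f = f"
  by (rule poly_mapping_eqI) (simp add: scale_def Poly_Mapping.map.rep_eq when_def)

lemma word_algebra_mult_basis:
  assumes "shuffle_compatible_on_words st"
    and "\<alpha> \<in> words" "\<beta> \<in> words" "disjoint_words \<alpha> \<beta>"
  shows "basis_elem st \<alpha> \<otimes>\<^bsub>word_algebra st\<^esub> basis_elem st \<beta> =
    (\<Sum>\<gamma>\<in>#Sh \<alpha> \<beta>. basis_elem st \<gamma>)"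
  using class_mult_eq[OF assms]
  by (simp add: word_algebra_def basis_elem_def[of st \<alpha>] basis_elem_def[of st \<beta>] scale_one)

section \<open>Quasisymmetric functions and the algebra of peaks\<close>

text \<open>A power series in ordered variables \<open>x\<^sub>0, x\<^sub>1, x\<^sub>2, \<dots>\<close> (indexed from 0 rather than 1) is the
  function assigning to each monomial its coefficient, where the monomial
  \<open>x\<^sub>i\<^sub>1 \<cdots> x\<^sub>i\<^sub>n\<close> is represented by the multiset \<open>{#i\<^sub>1, \<dots>, i\<^sub>n#}\<close>.\<close>

type_synonym power_series = "nat multiset \<Rightarrow> rat"

definition ps_mult :: "power_series \<Rightarrow> power_series \<Rightarrow> power_series" where
  "ps_mult f g M = (\<Sum>A | A \<subseteq># M. f A * g (M - A))"

definition ps_one :: power_series where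
  "ps_one M = (if M = {#} then 1 else 0)"

definition bounded_degree :: "power_series \<Rightarrow> bool" where
  "bounded_degree f \<longleftrightarrow> (\<exists>d. \<forall>M. f M \<noteq> 0 \<longrightarrow> size M \<le> d)"

definition quasisymmetric :: "power_series \<Rightarrow> bool" where
  "quasisymmetric f \<longleftrightarrow>
     (\<forall>M r. strict_mono_on (set_mset M) r \<longrightarrow> f (image_mset r M) = f M)"

definition QSym :: "(rat, power_series) module" where
  "QSym =
     \<lparr>carrier = {f. bounded_degree f \<and> quasisymmetric f},
      monoid.mult = ps_mult,
      one = ps_one,
      ring.zero = (\<lambda>M. 0),
      add = (\<lambda>f g M. f M + g M),
      module.smult = (\<lambda>c f M. c * f M)\<rparr>"

text \<open>The fundamental quasisymmetric function of degree \<open>n\<close>, for \<open>D \<subseteq> {1..n - 1}\<close>.\<close>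

definition F :: "nat \<Rightarrow> nat set \<Rightarrow> power_series" where
  "F n D M = of_nat (card {is. length is = n \<and> sorted is \<and>
     (\<forall>j\<in>D. is ! (j - 1) < is ! j) \<and> mset is = M})"

definition K :: "nat \<Rightarrow> nat set \<Rightarrow> power_series" where
  "K n S M = (if n = 0 then ps_one M
     else 2 ^ (card S + 1) * (\<Sum>D | D \<subseteq> {1..n - 1} \<and> S \<subseteq> sym_diff D (Suc ` D). F n D M))"

definition permutation_words :: "nat list set" where
  "permutation_words = {\<pi>. distinct \<pi> \<and> \<pi> \<in> words}"

definition Peak_algebra :: "(rat, power_series) module" where
  "Peak_algebra = QSym
     \<lparr>carrier := {f. \<exists>P c. finite P \<and> P \<subseteq> permutation_words \<and>
        f = (\<lambda>M. \<Sum>\<pi>\<in>P. c \<pi> * K (length \<pi>) (Peak \<pi>) M)}\<rparr>"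

section \<open>Algebra isomorphisms\<close>

definition algebra_iso ::
    "'r ring \<Rightarrow> ('r, 'a) module \<Rightarrow> ('r, 'b) module \<Rightarrow> ('a \<Rightarrow> 'b) \<Rightarrow> bool" where
  "algebra_iso R A B \<phi> \<longleftrightarrow> algebra R A \<and> algebra R B \<and> \<phi> \<in> ring_iso A B \<and>
     (\<forall>c\<in>carrier R. \<forall>a\<in>carrier A. \<phi> (c \<odot>\<^bsub>A\<^esub> a) = c \<odot>\<^bsub>B\<^esub> \<phi> a)"

end

theory Submission
  imports Defs
begin

text \<open>The coefficient of a monomial in \<open>K n S\<close> is \<open>2 ^ d\<close>, with \<open>d\<close> the number of variables that
  occur, if no element of \<open>S\<close> lies strictly inside a block of equal variables, and \<open>0\<close>
  otherwise. Hence \<open>K n (Cliff \<alpha>)\<close> is a product, over the variables, of the one-variable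
  functions \<open>v \<mapsto> (2 if v has no cliff, 1 if v is empty, else 0)\<close> evaluated at consecutive factors
  of \<open>\<alpha>\<close>. The one-variable function is itself the convolution of the indicators of strictly
  decreasing and of weakly increasing words, each of which is multiplicative for shuffles of
  disjoint words; convolutions of multiplicative functions are multiplicative, which is the
  product formula for peak functions, valid directly for words.

  The peak functions are linearly independent: the monomial with ascent set \<open>T\<close> occurs in
  \<open>K n S\<close> iff \<open>S \<subseteq> T \<union> (T + 1)\<close>, a triangular pattern for the weight \<open>\<Sum>i\<in>S. n - i\<close>. With the
  product formula this gives shuffle-compatibility, and it makes the linear map to the algebra of
  peaks injective, so that the algebra axioms on both sides are inherited from power series.\<close>

section \<open>Peak functions on monomials\<close>

text \<open>These are exactly the cliff sets of words of length \<open>n\<close>, and already the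
  peak sets of permutations: see \<open>sparse_set_Cliff\<close> and
  \<open>ex_permutation_Peak\<close>.\<close>

definition sparse_set :: "nat \<Rightarrow> nat set \<Rightarrow> bool" where
  "sparse_set n S \<longleftrightarrow> S \<subseteq> {2..n - 1} \<and> (\<forall>i\<in>S. Suc i \<notin> S)"

lemma sparse_set_Cliff: "sparse_set (length \<alpha>) (Cliff \<alpha>)"
  by (auto simp: sparse_set_def Cliff_def)

lemma finite_sparse_set: "sparse_set n S \<Longrightarrow> finite S"
  unfolding sparse_set_def using finite_subset by blast

lemma sparse_set_bounds:
  assumes "sparse_set n S" "i \<in> S"
  shows "2 \<le> i" "i < n"
proof -
  have "i \<in> {2..n - 1}"
    using assms by (auto simp: sparse_set_def)
  then show "2 \<le> i" "i < n"
    by auto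
qed

text \<open>The pairs \<open>{i - 1, i}\<close> are disjoint and each meets \<open>E\<close>, so the
  conditions are independent. With \<open>E\<close> the ascent set of a monomial, this counts the
  terms of Stembridge's sum in which the monomial occurs.\<close>

lemma card_subsets_splitting_pairs:
  assumes "finite S" "finite E"
    and "\<forall>i\<in>S. Suc i \<notin> S" "\<forall>i\<in>S. 1 \<le> i" "\<forall>i\<in>S. i \<in> E \<or> i - 1 \<in> E"
  shows "2 ^ card S * card {D. D \<subseteq> E \<and> (\<forall>i\<in>S. (i \<in> D) \<noteq> (i - 1 \<in> D))} = 2 ^ card E"
  using assms(1,3-)
proof (induction S rule: finite_induct)
  case empty
  then show ?case
    using card_Pow[OF \<open>finite E\<close>] by (simp add: Pow_def)
next
  case (insert i S)
  \<comment> \<open>Adding or removing a point of \<open>{i - 1, i} \<inter> E\<close> flips the condition at \<open>i\<close> only, so it halves the count.\<close>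
  define A where "A = {D. D \<subseteq> E \<and> (\<forall>i\<in>S. (i \<in> D) \<noteq> (i - 1 \<in> D))}"
  define B where "B = {D \<in> A. (i \<in> D) \<noteq> (i - 1 \<in> D)}"
  obtain e where e: "e \<in> E" "e = i \<or> e = i - 1"
    using insert.prems by blast
  have "i \<ge> 1"
    using insert.prems by simp
  have fresh: "e \<noteq> j" "e \<noteq> j - 1" if "j \<in> S" for j
  proof -
    have "j \<noteq> i" "Suc i \<noteq> j" "Suc j \<noteq> i" "1 \<le> j"
      using insert.prems insert.hyps that by auto
    then show "e \<noteq> j" "e \<noteq> j - 1"
      using e(2) \<open>i \<ge> 1\<close> by auto
  qed
  have "A \<subseteq> Pow E"
    by (auto simp: A_def)
  then have "finite A"
    using \<open>finite E\<close> finite_subset by blast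
  have inA: "sym_diff D {e} \<in> A" if "D \<in> A" for D
  proof -
    have "j \<in> sym_diff D {e} \<longleftrightarrow> j \<in> D" "j - 1 \<in> sym_diff D {e} \<longleftrightarrow> j - 1 \<in> D" if "j \<in> S" for j
      using fresh[OF that] by blast+
    moreover have "sym_diff D {e} \<subseteq> E"
      using that e by (auto simp: A_def)
    ultimately show ?thesis
      using that unfolding A_def by blast
  qed
  have flip: "(i \<in> sym_diff D {e}) \<noteq> (i - 1 \<in> sym_diff D {e}) \<longleftrightarrow> (i \<in> D) = (i - 1 \<in> D)" for D
  proof -
    have "i \<noteq> i - 1"
      using \<open>i \<ge> 1\<close> by simp
    then show ?thesis
      using e(2) by (elim disjE) simp_all
  qed
  have "bij_betw (\<lambda>D. sym_diff D {e}) B (A - B)"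
  proof (rule bij_betw_byWitness[where f' = "\<lambda>D. sym_diff D {e}"])
    show "(\<lambda>D. sym_diff D {e}) ` B \<subseteq> A - B" "(\<lambda>D. sym_diff D {e}) ` (A - B) \<subseteq> B"
      using inA flip by (auto simp: B_def)
  qed auto
  then have "card B = card (A - B)"
    by (rule bij_betw_same_card)
  moreover have "B \<subseteq> A"
    by (auto simp: B_def)
  ultimately have "card A = 2 * card B"
    using \<open>finite A\<close> card_Diff_subset[of B A] card_mono[of A B] finite_subset[of B A] by linarith
  moreover have "2 ^ card S * card A = 2 ^ card E"
    using insert by (simp add: A_def)
  moreover have "{D. D \<subseteq> E \<and> (\<forall>i\<in>insert i S. (i \<in> D) \<noteq> (i - 1 \<in> D))} = B"
    by (auto simp: A_def B_def)
  ultimately show ?case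
    using insert.hyps by simp
qed

text \<open>Each value other than the smallest first appears at an ascent; this turns a count of
  ascents into a count of variables.\<close>

lemma card_set_sorted:
  fixes s :: "'a::linorder list"
  assumes "sorted s" "s \<noteq> []"
  shows "card (set s) = Suc (card {j \<in> {1..length s - 1}. s ! (j - 1) < s ! j})"
  using assms
proof (induction s rule: induct_list012)
  case (3 x y s)
  let ?asc = "\<lambda>s :: 'a list. {j \<in> {1..length s - 1}. s ! (j - 1) < s ! j}"
  have *: "?asc (x # y # s) = (if x < y then {1} else {}) \<union> Suc ` ?asc (y # s)" (is "?L = ?R")
  proof (rule Set.set_eqI)
    fix j
    show "j \<in> ?L \<longleftrightarrow> j \<in> ?R"
    proof (cases j)
      case (Suc j')
      then show ?thesis
        by (cases j') (auto simp: image_iff)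
    qed auto
  qed
  have "card (?asc (x # y # s)) = (if x < y then 1 else 0) + card (?asc (y # s))"
    unfolding * by (subst card_Un_disjoint) (auto simp: card_image)
  moreover have "x \<in> set (y # s) \<longleftrightarrow> \<not> x < y"
    using "3.prems" by auto
  then have "card (set (x # y # s)) = (if x < y then 1 else 0) + card (set (y # s))"
    by (simp add: card_insert_if insert_absorb)
  ultimately show ?case
    using 3 by simp
qed auto

lemma length_sorted_list_of_multiset: "length (sorted_list_of_multiset M) = size M"
  by (metis mset_sorted_list_of_multiset size_mset)

text \<open>A monomial has only one weakly increasing arrangement, so its coefficient is 0 or
  1.\<close>

lemma F_eq:
  "F n D M = (if size M = n \<and> (\<forall>j\<in>D. sorted_list_of_multiset M ! (j - 1) < sorted_list_of_multiset M ! j)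
     then 1 else 0)"
proof -
  have "{is. length is = n \<and> sorted is \<and> (\<forall>j\<in>D. is ! (j - 1) < is ! j) \<and> mset is = M} =
    {s \<in> {sorted_list_of_multiset M}. size M = n \<and> (\<forall>j\<in>D. s ! (j - 1) < s ! j)}"
    by (auto simp: sorted_sort_id length_sorted_list_of_multiset)
  then show ?thesis
    by (simp add: F_def Collect_conv_if)
qed

text \<open>For \<open>n > 0\<close>, the sets \<open>D\<close> that contribute lie in the ascent
  set \<open>E\<close> of the monomial and contain exactly one of \<open>i - 1\<close>,
  \<open>i\<close> for each \<open>i\<close> in \<open>S\<close>. If all these pairs meet
  \<open>E\<close>, there are \<open>2 ^ (card E - card S)\<close> of them, and
  \<open>card E + 1\<close> is the number of variables. Lists are indexed from 0, so the condition
  compares the two neighbours of place \<open>i\<close>.\<close>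

lemma K_eq:
  assumes "sparse_set n S"
  shows "K n S M = (if size M = n \<and>
      (\<forall>i\<in>S. sorted_list_of_multiset M ! (i - 2) < sorted_list_of_multiset M ! i)
    then 2 ^ card (set_mset M) else 0)"
proof (cases "n = 0 \<or> size M \<noteq> n")
  case True
  then show ?thesis
  proof
    assume "n = 0"
    then have "S = {}" using assms by (auto simp: sparse_set_def)
    then show ?thesis using \<open>n = 0\<close> by (simp add: K_def ps_one_def)
  next
    assume "size M \<noteq> n"
    then have "F n D M = 0" for D
      by (simp add: F_eq)
    then show ?thesis using \<open>size M \<noteq> n\<close> by (auto simp add: K_def ps_one_def)
  qed
next
  case False
  define s where "s = sorted_list_of_multiset M"
  define E where "E = {j \<in> {1..n - 1}. s ! (j - 1) < s ! j}"
  define Ds where "Ds = {D. D \<subseteq> E \<and> (\<forall>i\<in>S. (i \<in> D) \<noteq> (i - 1 \<in> D))}"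
  have S: "finite S" "\<And>i. i \<in> S \<Longrightarrow> 2 \<le> i \<and> i \<le> n - 1" "\<forall>i\<in>S. Suc i \<notin> S"
    using assms finite_sparse_set by (auto simp: sparse_set_def)
  have s: "sorted s" "length s = n" "set s = set_mset M"
    using False by (auto simp: s_def length_sorted_list_of_multiset)
  have mem: "S \<subseteq> sym_diff D (Suc ` D) \<longleftrightarrow> (\<forall>i\<in>S. (i \<in> D) \<noteq> (i - 1 \<in> D))" for D
  proof -
    have "i \<in> sym_diff D (Suc ` D) \<longleftrightarrow> (i \<in> D) \<noteq> (i - 1 \<in> D)" if "i \<in> S" for i
      using S(2)[OF that] by (cases i) auto
    then show ?thesis
      unfolding subset_eq by (rule ball_cong[OF refl])
  qed
  have Ds_eq: "Ds = {D \<in> {D. D \<subseteq> {1..n - 1} \<and> S \<subseteq> sym_diff D (Suc ` D)}. \<forall>j\<in>D. s ! (j - 1) < s ! j}"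
    unfolding Ds_def E_def mem by auto
  have "F n D M = (if \<forall>j\<in>D. s ! (j - 1) < s ! j then 1 else 0)" for D
    using False by (simp add: F_eq s_def)
  then have "(\<Sum>D | D \<subseteq> {1..n - 1} \<and> S \<subseteq> sym_diff D (Suc ` D). F n D M) = of_nat (card Ds)"
    unfolding Ds_eq by (simp add: sum.If_cases Int_def)
  then have K: "K n S M = 2 ^ (card S + 1) * of_nat (card Ds)"
    using False by (simp add: K_def)
  have meets: "i \<in> E \<or> i - 1 \<in> E \<longleftrightarrow> s ! (i - 2) < s ! i" if "i \<in> S" for i
  proof -
    have "s ! (i - 2) \<le> s ! (i - 1)" "s ! (i - 1) \<le> s ! i"
      using s S(2)[OF that] by (auto intro!: sorted_nth_mono)
    moreover have "i - 1 - 1 = i - 2"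
      by simp
    ultimately show ?thesis
      using S(2)[OF that] unfolding E_def by auto
  qed
  show ?thesis
  proof (cases "\<forall>i\<in>S. s ! (i - 2) < s ! i")
    case True
    have "finite E"
      by (simp add: E_def)
    then have "2 ^ card S * card Ds = 2 ^ card E"
      unfolding Ds_def using S meets True
      by (intro card_subsets_splitting_pairs) fastforce+
    then have "2 ^ (card S + 1) * card Ds = 2 ^ Suc (card E)"
      by simp
    then have "rat_of_nat (2 ^ (card S + 1) * card Ds) = of_nat (2 ^ Suc (card E))"
      by presburger
    moreover have "card (set_mset M) = Suc (card E)"
      using card_set_sorted[of s] s False by (auto simp: E_def)
    ultimately show ?thesis
      using K True False by (simp add: s_def)
  next
    case no: False
    then obtain i where "i \<in> S" "\<not> s ! (i - 2) < s ! i"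
      by blast
    \<comment> \<open>Neither \<open>i\<close> nor \<open>i - 1\<close> is an ascent, so no
      \<open>D\<close> inside \<open>E\<close> contains exactly one of them.\<close>
    then have "Ds = {}"
      using meets by (auto simp: Ds_def)
    then show ?thesis
      using K no by (auto simp: s_def)
  qed
qed

section \<open>Shuffles and splittings of words\<close>

lemma Sh_Nil2 [simp]: "Sh \<alpha> [] = {#\<alpha>#}"
  by (cases \<alpha>) auto

text \<open>The library's \<open>sum_mset_product\<close> restricts the type of the summation indices.\<close>

lemma sum_mset_mult_sum_mset:
  fixes f :: "'a \<Rightarrow> 'c::semiring_0"
  shows "(\<Sum>x\<in>#A. f x) * (\<Sum>y\<in>#B. g y) = (\<Sum>x\<in>#A. \<Sum>y\<in>#B. f x * g y)"
  by (induction A) (simp_all add: distrib_right sum_mset_distrib_left sum_mset.distrib)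

text \<open>Cutting a shuffle in two also cuts \<alpha> and \<beta>, and the halves are shuffles of
  the corresponding pieces; conversely each such pair of halves arises once, with multiplicity. This
  is the compatibility of shuffling with deconcatenation.\<close>

lemma sum_Sh_splits:
  fixes h :: "'a list \<Rightarrow> 'a list \<Rightarrow> 'b::comm_monoid_add"
  shows "(\<Sum>\<gamma>\<in>#Sh \<alpha> \<beta>. \<Sum>j\<le>length \<gamma>. h (take j \<gamma>) (drop j \<gamma>)) =
    (\<Sum>i\<le>length \<alpha>. \<Sum>j\<le>length \<beta>.
      \<Sum>u\<in>#Sh (take i \<alpha>) (take j \<beta>). \<Sum>v\<in>#Sh (drop i \<alpha>) (drop j \<beta>). h u v)"
proof (induction \<alpha> \<beta> arbitrary: h rule: Sh.induct)
  case (3 a \<alpha> b \<beta>)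
  show ?case
    \<comment> \<open>For cuts with a nonempty prefix, the first letter of the shuffle is absorbed
      into \<open>h\<close>.\<close>
    using "3.IH"(1)[of "\<lambda>u. h (a # u)"] "3.IH"(2)[of "\<lambda>u. h (b # u)"]
    by (simp add: sum.atMost_Suc_shift sum_mset.distrib sum.distrib multiset.map_comp comp_def ac_simps
        del: sum.atMost_Suc)
qed auto

text \<open>Two sorted words have exactly one sorted shuffle, their merge; if either word is
  unsorted, so is every shuffle.\<close>

lemma sum_Sh_sorted_wrt:
  assumes "transp R" "\<forall>a\<in>set \<alpha>. \<forall>b\<in>set \<beta>. R a b \<noteq> R b a"
  shows "(\<Sum>\<gamma>\<in>#Sh \<alpha> \<beta>. of_bool (sorted_wrt R \<gamma>)) =
    (of_bool (sorted_wrt R \<alpha>) * of_bool (sorted_wrt R \<beta>) :: 'b::semiring_1)"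
  using assms(2)
proof (induction \<alpha> \<beta> rule: Sh.induct)
  case (3 a \<alpha> b \<beta>)
  have trans: "R x z" if "R x y" "R y z" for x y z
    using assms(1) that by (rule transpD)
  have Cons: "(\<Sum>\<gamma>\<in>#Sh \<xi> \<eta>. of_bool (sorted_wrt R (c # \<gamma>))) =
      (of_bool (\<forall>x\<in>set \<xi> \<union> set \<eta>. R c x) * (\<Sum>\<gamma>\<in>#Sh \<xi> \<eta>. of_bool (sorted_wrt R \<gamma>)) :: 'b)" for c \<xi> \<eta>
    unfolding sum_mset_distrib_left
    by (intro arg_cong[where f = sum_mset] image_mset_cong) (auto simp: set_mset_Sh set_shuffles)
  have IH: "(\<Sum>\<gamma>\<in>#Sh \<alpha> (b # \<beta>). of_bool (sorted_wrt R \<gamma>)) =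
      (of_bool (sorted_wrt R \<alpha>) * of_bool (sorted_wrt R (b # \<beta>)) :: 'b)"
    "(\<Sum>\<gamma>\<in>#Sh (a # \<alpha>) \<beta>. of_bool (sorted_wrt R \<gamma>)) =
      (of_bool (sorted_wrt R (a # \<alpha>)) * of_bool (sorted_wrt R \<beta>) :: 'b)"
    using 3 by auto
  have split: "(\<Sum>\<gamma>\<in>#Sh (a # \<alpha>) (b # \<beta>). of_bool (sorted_wrt R \<gamma>)) =
      (of_bool ((\<forall>x\<in>set \<alpha> \<union> set (b # \<beta>). R a x) \<and> sorted_wrt R \<alpha> \<and> sorted_wrt R (b # \<beta>)) +
       of_bool ((\<forall>x\<in>set (a # \<alpha>) \<union> set \<beta>. R b x) \<and> sorted_wrt R (a # \<alpha>) \<and> sorted_wrt R \<beta>) :: 'b)"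
    by (simp only: Sh.simps image_mset_union sum_mset.union multiset.map_comp comp_def Cons IH of_bool_conj)
  \<comment> \<open>The head that precedes the other must come first, so one of the two summands
    vanishes.\<close>
  consider "R a b" "\<not> R b a" | "R b a" "\<not> R a b"
    using 3 by auto
  then show ?case
  proof cases
    case 1
    then have "(\<forall>x\<in>set \<alpha> \<union> set (b # \<beta>). R a x) \<and> sorted_wrt R \<alpha> \<and> sorted_wrt R (b # \<beta>) \<longleftrightarrow>
        sorted_wrt R (a # \<alpha>) \<and> sorted_wrt R (b # \<beta>)"
      by (auto dest: trans)
    moreover have "\<not> (\<forall>x\<in>set (a # \<alpha>) \<union> set \<beta>. R b x)"
      using 1 by auto
    ultimately show ?thesis
      unfolding split by (simp only: of_bool_conj) simp
  next
    case 2
    then have "(\<forall>x\<in>set (a # \<alpha>) \<union> set \<beta>. R b x) \<and> sorted_wrt R (a # \<alpha>) \<and> sorted_wrt R \<beta> \<longleftrightarrow>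
        sorted_wrt R (a # \<alpha>) \<and> sorted_wrt R (b # \<beta>)"
      by (auto dest: trans)
    moreover have "\<not> (\<forall>x\<in>set \<alpha> \<union> set (b # \<beta>). R a x)"
      using 2 by auto
    ultimately show ?thesis
      unfolding split by (simp only: of_bool_conj) simp
  qed
qed auto

section \<open>The one-variable function and cliff-free words\<close>

definition vee :: "nat list \<Rightarrow> rat" where
  "vee \<gamma> = (\<Sum>j\<le>length \<gamma>. of_bool (sorted_wrt (>) (take j \<gamma>)) * of_bool (sorted (drop j \<gamma>)))"

text \<open>After \<open>sum_Sh_splits\<close>, the prefixes are handled by
  \<open>sum_Sh_sorted_wrt\<close> for \<open>>\<close> and the suffixes for \<open>\<le>\<close>.
  Disjointness makes each relation hold in exactly one direction between letters of the two
  words.\<close>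

lemma sum_Sh_vee:
  assumes "disjoint_words \<alpha> \<beta>"
  shows "(\<Sum>\<gamma>\<in>#Sh \<alpha> \<beta>. vee \<gamma>) = vee \<alpha> * vee \<beta>"
proof -
  have neq: "\<forall>a\<in>set \<alpha>. \<forall>b\<in>set \<beta>. a \<noteq> b"
    using assms by (auto simp: disjoint_words_def)
  have dec: "(\<Sum>u\<in>#Sh (take i \<alpha>) (take j \<beta>). of_bool (sorted_wrt (>) u)) =
      (of_bool (sorted_wrt (>) (take i \<alpha>)) * of_bool (sorted_wrt (>) (take j \<beta>)) :: rat)" for i j
  proof (rule sum_Sh_sorted_wrt)
    show "\<forall>a\<in>set (take i \<alpha>). \<forall>b\<in>set (take j \<beta>). (a > b) \<noteq> (b > a)"
      using neq by (meson in_set_takeD linorder_neqE_nat order_less_asym)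
  qed auto
  have inc: "(\<Sum>v\<in>#Sh (drop i \<alpha>) (drop j \<beta>). of_bool (sorted v)) =
      (of_bool (sorted (drop i \<alpha>)) * of_bool (sorted (drop j \<beta>)) :: rat)" for i j
  proof (rule sum_Sh_sorted_wrt)
    show "\<forall>a\<in>set (drop i \<alpha>). \<forall>b\<in>set (drop j \<beta>). (a \<le> b) \<noteq> (b \<le> a)"
      using neq by (meson in_set_dropD le_cases le_antisym)
  qed auto
  have "(\<Sum>\<gamma>\<in>#Sh \<alpha> \<beta>. vee \<gamma>) = (\<Sum>i\<le>length \<alpha>. \<Sum>j\<le>length \<beta>.
      (\<Sum>u\<in>#Sh (take i \<alpha>) (take j \<beta>). of_bool (sorted_wrt (>) u)) *
      (\<Sum>v\<in>#Sh (drop i \<alpha>) (drop j \<beta>). of_bool (sorted v)))"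
    unfolding vee_def sum_Sh_splits[where h = "\<lambda>u v. of_bool (sorted_wrt (>) u) * of_bool (sorted v)"]
    by (simp only: sum_mset_mult_sum_mset)
  then show ?thesis
    unfolding dec inc vee_def by (simp only: sum_product mult_ac)
qed

text \<open>A leading descent neither is nor creates a cliff; after a leading weak ascent, the top
  of the next descent would be a cliff.\<close>

lemma Cliff_Cons_Cons_eq_empty_iff:
  "Cliff (a # b # \<gamma>) = {} \<longleftrightarrow> (if a > b then Cliff (b # \<gamma>) = {} else sorted (b # \<gamma>))"
proof (induction \<gamma> arbitrary: a b)
  case Nil
  then show ?case
    by (auto simp: Cliff_def)
next
  case (Cons c \<gamma>)
  have "Cliff (a # b # c # \<gamma>) = (if a \<le> b \<and> b > c then {2} else {}) \<union> Suc ` Cliff (b # c # \<gamma>)"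
    (is "?L = ?R")
  proof (rule Set.set_eqI)
    fix i
    consider "i = 0" | "i = 1" | "i = 2" | j where "i = Suc (Suc (Suc j))"
      by (metis One_nat_def numeral_2_eq_2 not0_implies_Suc)
    then show "i \<in> ?L \<longleftrightarrow> i \<in> ?R"
      by cases (auto simp: Cliff_def image_iff)
  qed
  then have "Cliff (a # b # c # \<gamma>) = {} \<longleftrightarrow> \<not> (a \<le> b \<and> b > c) \<and> Cliff (b # c # \<gamma>) = {}"
    by auto
  then show ?case
    using Cons[of b c] by (auto simp: not_less intro: order_trans[of b c])
qed

text \<open>Cliff-free words decrease strictly, then increase weakly. A nonempty one has exactly two
  cuts into such parts, since the last letter of its maximal decreasing prefix may go to either
  side.\<close>

lemma vee_eq: "vee \<gamma> = (if \<gamma> = [] then 1 else if Cliff \<gamma> = {} then 2 else 0)"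
proof (induction \<gamma> rule: induct_list012)
  case 1
  then show ?case by (simp add: vee_def)
next
  case (2 a)
  then show ?case by (simp add: vee_def Cliff_def)
next
  case (3 a b \<gamma>)
  show ?case
  proof (cases "a > b")
    case True
    have *: "sorted_wrt (>) (a # b # x) = sorted_wrt (>) (b # x)" for x
      using True by auto
    \<comment> \<open>The empty prefix contributes 0, and a cut after \<open>j + 1\<close> letters
      here amounts to a cut of \<open>b # \<gamma>\<close> after \<open>j\<close>.\<close>
    have "vee (a # b # \<gamma>) = vee (b # \<gamma>)"
      unfolding vee_def using True
      by (simp add: sum.atMost_Suc_shift * del: sum.atMost_Suc sorted_wrt.simps(2)) simp
    then show ?thesis
      using True 3 by (simp add: Cliff_Cons_Cons_eq_empty_iff)
  next
    case False
    \<comment> \<open>Only prefixes of length 0 and 1 are decreasing, and both cuts require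
      \<open>b # \<gamma>\<close> to be sorted.\<close>
    then have "vee (a # b # \<gamma>) = 2 * of_bool (sorted (b # \<gamma>))"
      unfolding vee_def
      by (simp add: sum.atMost_Suc_shift del: sum.atMost_Suc) auto
    then show ?thesis
      using False by (simp add: Cliff_Cons_Cons_eq_empty_iff)
  qed
qed

section \<open>The product of peak functions\<close>

lemma Cliff_take: "Cliff (take p \<gamma>) = {i \<in> Cliff \<gamma>. i < p}"
  by (auto simp: Cliff_def)

text \<open>The bound \<open>2 \<le> i\<close> removes a cliff at the first letter of the suffix,
  whose left neighbour is cut off.\<close>

lemma Cliff_drop: "Cliff (drop p \<gamma>) = {i. 2 \<le> i \<and> p + i \<in> Cliff \<gamma>}"
  by (auto simp: Cliff_def nth_append)

section \<open>Splitting off the largest variable\<close>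

lemma sorted_list_of_multiset_append_max:
  assumes "\<And>x. x \<in># M \<Longrightarrow> x \<le> m"
  shows "sorted_list_of_multiset (M + replicate_mset k m) = sorted_list_of_multiset M @ replicate k m"
proof -
  have "sorted (sorted_list_of_multiset M @ replicate k m)"
    using assms by (auto simp: sorted_append)
  moreover have "mset (sorted_list_of_multiset M @ replicate k m) = M + replicate_mset k m"
    by simp
  ultimately show ?thesis
    by (metis sorted_list_of_multiset_mset sorted_sort_id)
qed

lemma K_Cliff_eq_0: "size M \<noteq> length \<gamma> \<Longrightarrow> K (length \<gamma>) (Cliff \<gamma>) M = 0"
  by (simp add: K_eq[OF sparse_set_Cliff])

text \<open>The copies of \<open>m\<close> end the sorted monomial, so only the cut after
  \<open>size M\<close> letters can contribute. A cliff inside the prefix keeps its condition, one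
  whose neighbours straddle the cut imposes none, and one inside the suffix makes the coefficient 0.
  Summing over all cuts gives the shape that \<open>sum_Sh_splits\<close> handles.\<close>

lemma K_Cliff_append_max:
  assumes less: "\<And>x. x \<in># M \<Longrightarrow> x < m"
  shows "K (length \<gamma>) (Cliff \<gamma>) (M + replicate_mset k m) =
    (\<Sum>j\<le>length \<gamma>. K (length (take j \<gamma>)) (Cliff (take j \<gamma>)) M *
      (if length (drop j \<gamma>) = k then vee (drop j \<gamma>) else 0))"
proof (cases "length \<gamma> = size M + k")
  case False
  then have "K (length (take j \<gamma>)) (Cliff (take j \<gamma>)) M *
      (if length (drop j \<gamma>) = k then vee (drop j \<gamma>) else 0) = 0" if "j \<le> length \<gamma>" for j
  proof (cases "length (drop j \<gamma>) = k")
    case True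
    then have "size M \<noteq> length (take j \<gamma>)"
      using False that by auto
    from K_Cliff_eq_0[OF this] show ?thesis
      by (simp only: mult_zero_left)
  qed simp
  then show ?thesis
    using False by (simp add: K_Cliff_eq_0 sum.neutral del: length_take length_drop)
next
  case True
  define p where "p = size M"
  define s where "s = sorted_list_of_multiset M"
  define s' where "s' = s @ replicate k m"
  have len: "length s = p" "length \<gamma> = p + k"
    using True by (simp_all add: s_def p_def length_sorted_list_of_multiset)
  have s'_less: "s' ! i = s ! i" "s ! i < m" if "i < p" for i
    using that less len nth_mem[of i s] by (auto simp: s'_def nth_append s_def)
  have s'_ge: "s' ! i = m" if "p \<le> i" "i < p + k" for i
    using that len by (auto simp: s'_def nth_append)
  have s': "sorted_list_of_multiset (M + replicate_mset k m) = s'"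
    using less sorted_list_of_multiset_append_max[of M m k] by (auto simp: s'_def s_def less_imp_le)
  have "m \<notin># M"
    using less by blast
  then have card: "card (set_mset (M + replicate_mset k m)) = card (set_mset M) + (if k = 0 then 0 else 1)"
    by simp
  have bound: "2 \<le> i \<and> i < p + k" if "i \<in> Cliff \<gamma>" for i
    using that len by (auto simp: Cliff_def)
  have "s' ! (i - 2) < s' ! i \<longleftrightarrow> (if i < p then s ! (i - 2) < s ! i else i - 2 < p)"
    if "i \<in> Cliff \<gamma>" for i
  proof -
    consider "i < p" | "p \<le> i" "i - 2 < p" | "p \<le> i" "p \<le> i - 2"
      by linarith
    then show ?thesis
      using bound[OF that] s'_ge[of "i - 2"] by cases (auto simp: s'_less s'_ge)
  qed
  then have "(\<forall>i\<in>Cliff \<gamma>. s' ! (i - 2) < s' ! i) \<longleftrightarrow>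
      (\<forall>i\<in>Cliff \<gamma>. if i < p then s ! (i - 2) < s ! i else i - 2 < p)"
    by (rule ball_cong[OF refl])
  also have "\<dots> \<longleftrightarrow> (\<forall>i\<in>Cliff (take p \<gamma>). s ! (i - 2) < s ! i) \<and> (\<forall>i\<in>Cliff \<gamma>. i - 2 < p)"
    unfolding Cliff_take by (smt (verit) le_less_trans diff_le_self mem_Collect_eq)
  also have "(\<forall>i\<in>Cliff \<gamma>. i - 2 < p) \<longleftrightarrow> Cliff (drop p \<gamma>) = {}"
  proof -
    have "i - p \<in> Cliff (drop p \<gamma>)" if "i \<in> Cliff \<gamma>" "\<not> i - 2 < p" for i
      using that bound[OF that(1)] by (auto simp: Cliff_drop)
    moreover have "p + i \<in> Cliff \<gamma>" "\<not> p + i - 2 < p" if "i \<in> Cliff (drop p \<gamma>)" for i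
      using that by (auto simp: Cliff_drop)
    ultimately show ?thesis
      by blast
  qed
  finally have cond: "(\<forall>i\<in>Cliff \<gamma>. s' ! (i - 2) < s' ! i) \<longleftrightarrow>
      (\<forall>i\<in>Cliff (take p \<gamma>). s ! (i - 2) < s ! i) \<and> Cliff (drop p \<gamma>) = {}" .
  have "size (M + replicate_mset k m) = length \<gamma>" "size M = length (take p \<gamma>)"
    using len by (simp_all add: p_def)
  then have K: "K (length \<gamma>) (Cliff \<gamma>) (M + replicate_mset k m) =
      (if (\<forall>i\<in>Cliff (take p \<gamma>). s ! (i - 2) < s ! i) \<and> Cliff (drop p \<gamma>) = {}
       then 2 ^ (card (set_mset M) + (if k = 0 then 0 else 1)) else 0)"
    "K (length (take p \<gamma>)) (Cliff (take p \<gamma>)) M =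
      (if \<forall>i\<in>Cliff (take p \<gamma>). s ! (i - 2) < s ! i then 2 ^ card (set_mset M) else 0)"
    unfolding K_eq[OF sparse_set_Cliff] s' cond card s_def[symmetric] by simp_all
  have "vee (drop p \<gamma>) = (if k = 0 then 1 else if Cliff (drop p \<gamma>) = {} then 2 else 0)"
    "k = 0 \<Longrightarrow> Cliff (drop p \<gamma>) = {}"
    using len by (simp_all add: vee_eq Cliff_def)
  \<comment> \<open>For \<open>k > 0\<close> the new variable doubles a nonzero coefficient, which
    is the value 2 of \<open>vee\<close>; for \<open>k = 0\<close> the factor is
    \<open>vee [] = 1\<close>.\<close>
  with K have "K (length \<gamma>) (Cliff \<gamma>) (M + replicate_mset k m) =
      K (length (take p \<gamma>)) (Cliff (take p \<gamma>)) M * vee (drop p \<gamma>)"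
    by (cases "k = 0") (simp_all split: if_splits)
  also have "\<dots> = (\<Sum>j\<in>{p}. K (length (take j \<gamma>)) (Cliff (take j \<gamma>)) M *
      (if length (drop j \<gamma>) = k then vee (drop j \<gamma>) else 0))"
    using len by simp
  also have "\<dots> = (\<Sum>j\<le>length \<gamma>. K (length (take j \<gamma>)) (Cliff (take j \<gamma>)) M *
      (if length (drop j \<gamma>) = k then vee (drop j \<gamma>) else 0))"
    using len by (intro sum.mono_neutral_left) auto
  finally show ?thesis .
qed

text \<open>As \<open>m\<close> is not in \<open>M\<close>, a submultiset amounts to an independent
  choice of a part of \<open>M\<close> and a multiplicity of \<open>m\<close>.\<close>

lemma sum_submultisets_append:
  assumes "m \<notin># M"
  shows "(\<Sum>A | A \<subseteq># M + replicate_mset k m. f A) =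
    (\<Sum>A | A \<subseteq># M. \<Sum>i\<le>k. f (A + replicate_mset i m))"
proof -
  have "(\<Sum>A | A \<subseteq># M. \<Sum>i\<le>k. f (A + replicate_mset i m)) =
      (\<Sum>(A, i)\<in>{A. A \<subseteq># M} \<times> {..k}. f (A + replicate_mset i m))"
    by (simp add: sum.cartesian_product)
  also have "\<dots> = (\<Sum>A | A \<subseteq># M + replicate_mset k m. f A)"
  proof (rule sum.reindex_bij_witness[where
        i = "\<lambda>A. (filter_mset (\<lambda>x. x \<noteq> m) A, count A m)" and j = "\<lambda>(A, i). A + replicate_mset i m"])
    show "(\<lambda>(A, i). A + replicate_mset i m) (filter_mset (\<lambda>x. x \<noteq> m) A, count A m) = A" for A
      by (auto intro: multiset_eqI)
    show "(filter_mset (\<lambda>x. x \<noteq> m) A, count A m) \<in> {A. A \<subseteq># M} \<times> {..k}"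
      if "A \<in> {A. A \<subseteq># M + replicate_mset k m}" for A
    proof -
      have "count A x \<le> count (M + replicate_mset k m) x" for x
        using that by (simp add: subseteq_mset_def)
      note this[of m]
      moreover have "count (filter_mset (\<lambda>x. x \<noteq> m) A) x \<le> count M x" for x
        using \<open>\<And>x. count A x \<le> count (M + replicate_mset k m) x\<close>[of x] by auto
      ultimately show ?thesis
        using assms by (auto simp: subseteq_mset_def not_in_iff)
    qed
    fix p assume p: "p \<in> {A. A \<subseteq># M} \<times> {..k}"
    obtain A i where Ai: "p = (A, i)" "A \<subseteq># M" "i \<le> k"
      using p by auto
    then have "m \<notin># A"
      using assms mset_subset_eqD by metis
    then show "(filter_mset (\<lambda>x. x \<noteq> m) ((\<lambda>(A, i). A + replicate_mset i m) p),
        count ((\<lambda>(A, i). A + replicate_mset i m) p) m) = p"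
      using Ai by (auto intro!: multiset_eqI simp: not_in_iff)
    show "(\<lambda>(A, i). A + replicate_mset i m) p \<in> {A. A \<subseteq># M + replicate_mset k m}"
      using Ai by (auto simp: subseteq_mset_def intro: add_mono)
  qed (auto split: prod.splits)
  finally show ?thesis ..
qed


lemma K_Cliff_empty: "K (length \<gamma>) (Cliff \<gamma>) {#} = of_bool (\<gamma> = [])"
  using K_Cliff_eq_0[of "{#}" \<gamma>] by (cases "\<gamma> = []") (simp_all add: K_def ps_one_def)

text \<open>Splitting off the largest variable turns a peak function into the convolution of the
  peak function in the smaller variables with the one-variable function \<^const>\<open>vee\<close>; both
  are multiplicative for shuffles, hence so is their convolution.\<close>

lemma sum_Sh_K_Cliff:
  assumes dj: "disjoint_words \<alpha> \<beta>"
  shows "(\<Sum>\<gamma>\<in>#Sh \<alpha> \<beta>. K (length \<gamma>) (Cliff \<gamma>) M) =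
    ps_mult (K (length \<alpha>) (Cliff \<alpha>)) (K (length \<beta>) (Cliff \<beta>)) M"
proof -
  define P where "P \<gamma> = K (length \<gamma>) (Cliff \<gamma>)" for \<gamma>
  \<comment> \<open>\<open>q k\<close> gives the coefficient of the \<open>k\<close>-th power of a
    single variable.\<close>
  define q where "q k v = (if length v = k then vee v else 0)" for k and v :: "nat list"
  have P_split: "P \<gamma> (M + replicate_mset k m) = (\<Sum>j\<le>length \<gamma>. P (take j \<gamma>) M * q k (drop j \<gamma>))"
    if "\<And>x. x \<in># M \<Longrightarrow> x < m" for \<gamma> M k m
    unfolding P_def q_def using that by (rule K_Cliff_append_max)
  have dj': "disjoint_words (take i \<alpha>) (take j \<beta>)" "disjoint_words (drop i \<alpha>) (drop j \<beta>)"
    if "disjoint_words \<alpha> \<beta>" for i j \<alpha> \<beta>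
    using that set_take_subset[of i \<alpha>] set_take_subset[of j \<beta>]
      set_drop_subset[of i \<alpha>] set_drop_subset[of j \<beta>]
    by (auto simp: disjoint_words_def)
  \<comment> \<open>This is \<open>sum_Sh_vee\<close> graded by degree: only
    \<open>l = length \<xi>\<close> contributes on the right.\<close>
  have q_mult: "(\<Sum>v\<in>#Sh \<xi> \<eta>. q k v) = (\<Sum>l\<le>k. q l \<xi> * q (k - l) \<eta>)"
    if "disjoint_words \<xi> \<eta>" for k \<xi> \<eta>
  proof -
    have "(\<Sum>v\<in>#Sh \<xi> \<eta>. q k v) = (\<Sum>v\<in>#Sh \<xi> \<eta>. of_bool (length \<xi> + length \<eta> = k) * vee v)"
      by (intro arg_cong[where f = sum_mset] image_mset_cong) (auto simp: q_def length_Sh)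
    also have "\<dots> = of_bool (length \<xi> + length \<eta> = k) * (vee \<xi> * vee \<eta>)"
      by (simp only: sum_Sh_vee[OF that] flip: sum_mset_distrib_left)
    also have "\<dots> = (\<Sum>l\<le>k. if l = length \<xi> then q l \<xi> * q (k - l) \<eta> else 0)"
      by (auto simp: q_def)
    also have "\<dots> = (\<Sum>l\<le>k. q l \<xi> * q (k - l) \<eta>)"
      by (intro sum.cong) (auto simp: q_def)
    finally show ?thesis .
  qed
  have "(\<Sum>\<gamma>\<in>#Sh \<alpha> \<beta>. P \<gamma> M) = (\<Sum>A | A \<subseteq># M. P \<alpha> A * P \<beta> (M - A))"
    if "\<And>x. x \<in># M \<Longrightarrow> x < N" for N
    using that dj
  \<comment> \<open>Each step removes the variable \<open>N\<close>; \<alpha> and \<beta> vary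
    because the induction hypothesis is applied to their prefixes.\<close>
  proof (induction N arbitrary: M \<alpha> \<beta>)
    case 0
    then have "M = {#}"
      by auto
    moreover have "(\<Sum>\<gamma>\<in>#Sh \<alpha> \<beta>. of_bool (\<gamma> = [])) = (of_bool (\<alpha> = []) * of_bool (\<beta> = []) :: rat)"
      by (cases \<alpha>; cases \<beta>) (auto simp: multiset.map_comp comp_def)
    ultimately show ?case
      by (simp add: P_def K_Cliff_empty)
  next
    case (Suc N)
    \<comment> \<open>The variable \<open>N\<close> need not occur in \<open>M\<close>; then
      \<open>k = 0\<close>.\<close>
    define M' where "M' = filter_mset (\<lambda>x. x \<noteq> N) M"
    define k where "k = count M N"
    have M: "M = M' + replicate_mset k N"
      by (auto simp: M'_def k_def intro: multiset_eqI)
    have less: "x < N" if "x \<in># M'" for x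
      using that Suc.prems(1)[of x] by (auto simp: M'_def)
    have lessA: "x < N" if "x \<in># A" "A \<subseteq># M'" for x A
      by (rule less[OF mset_subset_eqD[OF that(2,1)]])
    have lessB: "x < N" if "x \<in># M' - A" for x A
      by (rule less[OF in_diffD[OF that]])
    have diff: "M' + replicate_mset k N - (A + replicate_mset l N) = M' - A + replicate_mset (k - l) N"
      if "A \<subseteq># M'" "l \<le> k" for A l
      using that by (auto intro!: multiset_eqI simp: subseteq_mset_def)
    have split: "P \<gamma> (M' + replicate_mset l N) = (\<Sum>j\<le>length \<gamma>. P (take j \<gamma>) M' * q l (drop j \<gamma>))"
      "A \<subseteq># M' \<Longrightarrow> P \<gamma> (A + replicate_mset l N) = (\<Sum>j\<le>length \<gamma>. P (take j \<gamma>) A * q l (drop j \<gamma>))"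
      "P \<gamma> (M' - A + replicate_mset l N) = (\<Sum>j\<le>length \<gamma>. P (take j \<gamma>) (M' - A) * q l (drop j \<gamma>))"
      for A \<gamma> l
      by (rule P_split, auto intro: less lessA lessB)+
    have "(\<Sum>\<gamma>\<in>#Sh \<alpha> \<beta>. P \<gamma> M) = (\<Sum>i\<le>length \<alpha>. \<Sum>j\<le>length \<beta>.
        (\<Sum>u\<in>#Sh (take i \<alpha>) (take j \<beta>). P u M') * (\<Sum>v\<in>#Sh (drop i \<alpha>) (drop j \<beta>). q k v))"
      unfolding M split(1) sum_Sh_splits[where h = "\<lambda>u v. P u M' * q k v"]
      by (simp only: sum_mset_mult_sum_mset)
    also have "\<dots> = (\<Sum>i\<le>length \<alpha>. \<Sum>j\<le>length \<beta>. \<Sum>A | A \<subseteq># M'. \<Sum>l\<le>k.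
        (P (take i \<alpha>) A * P (take j \<beta>) (M' - A)) * (q l (drop i \<alpha>) * q (k - l) (drop j \<beta>)))"
      by (simp only: Suc.IH[OF less dj'(1)[OF Suc.prems(2)]] q_mult[OF dj'(2)[OF Suc.prems(2)]] sum_product)
    \<comment> \<open>For each factorisation of the monomial, the cuts of \<alpha> and those of
      \<beta> are collected into separate factors.\<close>
    also have "\<dots> = (\<Sum>A | A \<subseteq># M'. \<Sum>l\<le>k. \<Sum>i\<le>length \<alpha>. \<Sum>j\<le>length \<beta>.
        (P (take i \<alpha>) A * q l (drop i \<alpha>)) * (P (take j \<beta>) (M' - A) * q (k - l) (drop j \<beta>)))"
      by (simp only: mult_ac
          sum.swap[of _ "{A. A \<subseteq># M'}" "{..length \<alpha>}"] sum.swap[of _ "{..k}" "{..length \<alpha>}"]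
          sum.swap[of _ "{A. A \<subseteq># M'}" "{..length \<beta>}"] sum.swap[of _ "{..k}" "{..length \<beta>}"])
    also have "\<dots> = (\<Sum>A | A \<subseteq># M'. \<Sum>l\<le>k.
        P \<alpha> (A + replicate_mset l N) * P \<beta> (M' - A + replicate_mset (k - l) N))"
      by (intro sum.cong refl) (simp only: mem_Collect_eq split sum_product)
    also have "\<dots> = (\<Sum>A | A \<subseteq># M. P \<alpha> A * P \<beta> (M - A))"
    proof -
      have "N \<notin># M'"
        by (simp add: M'_def)
      then show ?thesis
        unfolding M sum_submultisets_append[OF \<open>N \<notin># M'\<close>]
        by (intro sum.cong refl) (simp add: diff)
    qed
    finally show ?case .
  qed
  \<comment> \<open>Any strict bound on the variables can start the induction.\<close>
  moreover have "x < Suc (sum_mset M)" if "x \<in># M" for x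
    using that by (metis le_add1 less_Suc_eq_le multi_member_split sum_mset.add_mset)
  ultimately show ?thesis
    unfolding P_def ps_mult_def by blast
qed

section \<open>Linear independence and shuffle-compatibility\<close>

text \<open>The sorted index sequence rises by one on entering each place in \<open>T\<close>,
  places counted from 0; for \<open>T\<close> inside \<open>{1..n - 1}\<close> this monomial has
  ascent set \<open>T\<close>.\<close>

definition ascent_mset :: "nat \<Rightarrow> nat set \<Rightarrow> nat multiset" where
  "ascent_mset n T = mset (map (\<lambda>i. card {t \<in> T. t \<le> i}) [0..<n])"

lemma size_ascent_mset [simp]: "size (ascent_mset n T) = n"
  by (simp add: ascent_mset_def)

text \<open>The entries at \<open>i - 2\<close> and \<open>i\<close> differ by the number of
  elements of \<open>T\<close> among \<open>i - 1\<close> and \<open>i\<close>.\<close>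

lemma K_ascent_mset_eq_0_iff:
  assumes "sparse_set n S" "finite T"
  shows "K n S (ascent_mset n T) = 0 \<longleftrightarrow> \<not> S \<subseteq> T \<union> Suc ` T"
proof -
  define s where "s = map (\<lambda>i. card {t \<in> T. t \<le> i}) [0..<n]"
  have "sorted s"
    using \<open>finite T\<close> by (auto simp: s_def sorted_iff_nth_mono intro!: card_mono)
  then have s: "sorted_list_of_multiset (ascent_mset n T) = s"
    unfolding ascent_mset_def s_def[symmetric] by (simp add: sorted_sort_id)
  have "s ! (i - 2) < s ! i \<longleftrightarrow> i \<in> T \<union> Suc ` T" if "i \<in> S" for i
  proof -
    have i: "2 \<le> i" "i < n"
      using sparse_set_bounds[OF assms(1) that] by auto
    have "{t \<in> T. t \<le> i} = {t \<in> T. t \<le> i - 2} \<union> T \<inter> {i - 1, i}"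
      using i by auto
    moreover have "{t \<in> T. t \<le> i - 2} \<inter> (T \<inter> {i - 1, i}) = {}"
      using i by auto
    ultimately have "card {t \<in> T. t \<le> i} = card {t \<in> T. t \<le> i - 2} + card (T \<inter> {i - 1, i})"
      using \<open>finite T\<close> by (simp add: card_Un_disjoint)
    moreover have "s ! i = card {t \<in> T. t \<le> i}" "s ! (i - 2) = card {t \<in> T. t \<le> i - 2}"
      using i less_imp_diff_less[of i n 2] by (simp_all add: s_def)
    moreover have "0 < card (T \<inter> {i - 1, i}) \<longleftrightarrow> T \<inter> {i - 1, i} \<noteq> {}"
      using \<open>finite T\<close> by (simp only: card_gt_0_iff finite_Int simp_thms)
    ultimately have "s ! (i - 2) < s ! i \<longleftrightarrow> T \<inter> {i - 1, i} \<noteq> {}"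
      by linarith
    also have "\<dots> \<longleftrightarrow> i \<in> T \<union> Suc ` T"
      using i by (cases i) auto
    finally show ?thesis .
  qed
  then show ?thesis
    using K_eq[OF assms(1)] by (auto simp: s)
qed

text \<open>Send \<open>i\<close> in \<open>S\<close> to itself if it lies in \<open>T\<close> and
  to \<open>i - 1\<close> otherwise. This is an injection into \<open>T\<close>, since
  \<open>S\<close> has no consecutive elements, and the weight \<open>n - i\<close> never
  drops.\<close>

lemma sum_sparse_set_less:
  assumes S: "sparse_set n S" and T: "sparse_set n T" and sub: "S \<subseteq> T \<union> Suc ` T" and "S \<noteq> T"
  shows "(\<Sum>i\<in>S. n - i) < (\<Sum>i\<in>T. n - i)"
proof -
  define f where "f i = (if i \<in> T then i else i - 1)" for i
  have "finite S" "finite T"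
    using S T finite_sparse_set by blast+
  have pos: "1 \<le> i \<and> i < n" if "i \<in> S \<union> T" for i
    using that sparse_set_bounds[OF S, of i] sparse_set_bounds[OF T, of i] by auto
  have S_step: "Suc i \<notin> S" if "i \<in> S" for i
    using S that by (auto simp: sparse_set_def)
  have inj: "inj_on f S"
  proof (rule inj_onI)
    fix i j assume "i \<in> S" "j \<in> S" "f i = f j"
    then show "i = j"
      using pos[of i] pos[of j] S_step[of i] S_step[of j]
      by (cases i; cases j) (auto simp: f_def split: if_splits)
  qed
  have im: "f ` S \<subseteq> T"
    using sub by (auto simp: f_def)
  have le: "n - i \<le> n - f i" for i
    by (simp add: f_def diff_le_mono2)
  have reindex: "(\<Sum>i\<in>S. n - f i) = (\<Sum>t\<in>f ` S. n - t)"
    using inj by (simp add: sum.reindex)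
  show ?thesis
  \<comment> \<open>Either the injection is onto and some element moves, or \<open>T\<close> has a
    further element, of positive weight.\<close>
  proof (cases "f ` S = T")
    case True
    then obtain i where "i \<in> S" "i \<notin> T"
      using \<open>S \<noteq> T\<close> by (metis f_def image_cong image_ident subsetI subset_antisym image_eqI)
    then have "n - i < n - f i"
      using pos[of i] unfolding f_def by auto
    then have "(\<Sum>i\<in>S. n - i) < (\<Sum>i\<in>S. n - f i)"
      using le \<open>i \<in> S\<close> \<open>finite S\<close> by (intro sum_strict_mono_ex1) auto
    then show ?thesis
      using reindex True by simp
  next
    case False
    have "(\<Sum>i\<in>S. n - i) \<le> (\<Sum>i\<in>S. n - f i)"
      using le by (intro sum_mono)
    also have "\<dots> < (\<Sum>i\<in>T. n - i)"
    proof -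
      obtain t where "t \<in> T" "t \<notin> f ` S"
        using im False by blast
      then have "0 < n - t"
        using pos[of t] by simp
      then show ?thesis
        unfolding reindex using im \<open>t \<in> T\<close> \<open>t \<notin> f ` S\<close> \<open>finite T\<close>
        by (intro sum_strict_mono2[where b = t]) auto
    qed
    finally show ?thesis .
  qed
qed

text \<open>Take a term \<open>(m, T)\<close> of least weight among those with nonzero coefficient
  and evaluate at \<open>ascent_mset m T\<close>. Terms of another degree vanish there, and by
  \<open>sum_sparse_set_less\<close> a nonvanishing term of the same degree would have smaller
  weight.\<close>

lemma K_independent:
  assumes "finite I" and sparse: "\<And>n S. (n, S) \<in> I \<Longrightarrow> sparse_set n S"
    and zero: "\<And>M. (\<Sum>(n, S)\<in>I. c n S * K n S M) = 0"
    and "(n, S) \<in> I"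
  shows "c n S = 0"
proof (rule ccontr)
  assume "c n S \<noteq> 0"
  define w where "w = (\<lambda>(n, S :: nat set). \<Sum>i\<in>S. n - i)"
  define J where "J = {(n, S) \<in> I. c n S \<noteq> 0}"
  obtain m T where mT: "(m, T) \<in> J" and min: "\<And>p. p \<in> J \<Longrightarrow> w (m, T) \<le> w p"
  proof -
    have "(n, S) \<in> J"
      using \<open>(n, S) \<in> I\<close> \<open>c n S \<noteq> 0\<close> by (simp add: J_def)
    then show ?thesis
      using that ex_has_least_nat[of "\<lambda>p. p \<in> J" _ w] by fastforce
  qed
  then have T: "sparse_set m T" "(m, T) \<in> I" "c m T \<noteq> 0"
    using sparse by (auto simp: J_def)
  then have "finite T"
    using finite_sparse_set by blast
  let ?M = "ascent_mset m T"
  have "c n S * K n S ?M = 0" if "(n, S) \<in> I" "(n, S) \<noteq> (m, T)" for n S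
  proof (cases "n = m \<and> c n S \<noteq> 0")
    case True
    then have "(m, S) \<in> J" and S: "sparse_set m S" "S \<noteq> T"
      using that sparse by (auto simp: J_def)
    from min[OF this(1)] have "\<not> S \<subseteq> T \<union> Suc ` T"
      using sum_sparse_set_less[OF S(1) T(1) _ S(2)] by (auto simp: w_def)
    then show ?thesis
      using True K_ascent_mset_eq_0_iff[OF S(1) \<open>finite T\<close>] by simp
  qed (use sparse[OF that(1)] in \<open>auto simp: K_eq\<close>)
  then have "(case p of (n, S) \<Rightarrow> c n S * K n S ?M) = 0" if "p \<in> I" "p \<noteq> (m, T)" for p
    using that by (cases p) (simp only: split_conv)
  then have "(\<Sum>(n, S)\<in>I. c n S * K n S ?M) = (\<Sum>(n, S)\<in>{(m, T)}. c n S * K n S ?M)"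
    using \<open>finite I\<close> T(2) by (intro sum.mono_neutral_right) auto
  then have "K m T ?M = 0"
    using zero[of ?M] T by simp
  then show False
    using K_ascent_mset_eq_0_iff[OF T(1) \<open>finite T\<close>] by auto
qed

section \<open>From linear independence to shuffle-compatibility\<close>

lemma sum_mset_eq_sum_count:
  fixes f :: "'a \<Rightarrow> 'b::semiring_1"
  assumes "finite Z" "set_mset A \<subseteq> Z"
  shows "(\<Sum>x\<in>#A. f x) = (\<Sum>x\<in>Z. of_nat (count A x) * f x)"
  using assms(2)
proof (induction A)
  case (add x A)
  have "(\<Sum>y\<in>Z. of_nat (count (add_mset x A) y) * f y) =
      (\<Sum>y\<in>Z. (if y = x then f y else 0) + of_nat (count A y) * f y)"
    by (intro sum.cong) (auto simp: distrib_right)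
  also have "\<dots> = f x + (\<Sum>y\<in>Z. of_nat (count A y) * f y)"
    using add.prems \<open>finite Z\<close> by (simp add: sum.distrib)
  finally show ?case
    using add by simp
qed simp

lemma Cliff_map:
  assumes "strict_mono_on (set \<alpha>) f"
  shows "Cliff (map f \<alpha>) = Cliff \<alpha>"
proof -
  have "f x < f y \<longleftrightarrow> x < y" "f x \<le> f y \<longleftrightarrow> x \<le> y" if "x \<in> set \<alpha>" "y \<in> set \<alpha>" for x y
    using strict_mono_on_less[OF assms that] strict_mono_on_less_eq[OF assms that] by auto
  then show ?thesis
    unfolding Cliff_def by auto
qed

lemma Cliff_pack: "Cliff (pack \<alpha>) = Cliff \<alpha>"
  unfolding pack_def
proof (rule Cliff_map, rule strict_mono_onI)
  fix x y assume "x \<in> set \<alpha>" "y \<in> set \<alpha>" "x < y"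
  then have "{b \<in> set \<alpha>. b \<le> x} \<subseteq> {b \<in> set \<alpha>. b \<le> y}"
    "y \<in> {b \<in> set \<alpha>. b \<le> y}" "y \<notin> {b \<in> set \<alpha>. b \<le> x}"
    by auto
  then have "{b \<in> set \<alpha>. b \<le> x} \<subset> {b \<in> set \<alpha>. b \<le> y}"
    by blast
  then show "card {b \<in> set \<alpha>. b \<le> x} < card {b \<in> set \<alpha>. b \<le> y}"
    by (intro psubset_card_mono) auto
qed

text \<open>By \<open>sum_Sh_K_Cliff\<close>, the multiplicities of cliff sets among the shuffles
  are the coefficients of a product of peak functions that depends only on the lengths and cliff
  sets of the factors. Linear independence recovers the multiplicities from the product.\<close>

lemma shuffle_compatible_Cliff: "shuffle_compatible_on_words Cliff"
proof -
  have "image_mset Cliff (Sh \<alpha> \<beta>) = image_mset Cliff (Sh \<alpha>' \<beta>')"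
    if dj: "disjoint_words \<alpha> \<beta>" "disjoint_words \<alpha>' \<beta>'"
      and eq: "length \<alpha> = length \<alpha>'" "length \<beta> = length \<beta>'" "Cliff \<alpha> = Cliff \<alpha>'" "Cliff \<beta> = Cliff \<beta>'"
    for \<alpha> \<beta> \<alpha>' \<beta>'
  proof -
    define n where "n = length \<alpha> + length \<beta>"
    define Y where "Y = image_mset Cliff (Sh \<alpha> \<beta>)"
    define Y' where "Y' = image_mset Cliff (Sh \<alpha>' \<beta>')"
    \<comment> \<open>A common index set, so that the two expansions can be subtracted.\<close>
    define Z where "Z = set_mset Y \<union> set_mset Y'"
    have sum_Sh: "(\<Sum>\<gamma>\<in>#Sh \<xi> \<eta>. K (length \<gamma>) (Cliff \<gamma>) M) =
        (\<Sum>S\<in>Z. of_nat (count (image_mset Cliff (Sh \<xi> \<eta>)) S) * K n S M)"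
      if "length \<xi> + length \<eta> = n" "set_mset (image_mset Cliff (Sh \<xi> \<eta>)) \<subseteq> Z" for \<xi> \<eta> M
    proof -
      have "(\<Sum>\<gamma>\<in>#Sh \<xi> \<eta>. K (length \<gamma>) (Cliff \<gamma>) M) = (\<Sum>S\<in>#image_mset Cliff (Sh \<xi> \<eta>). K n S M)"
        using that(1) by (auto simp: multiset.map_comp length_Sh intro!: arg_cong[where f = sum_mset] image_mset_cong)
      also have "\<dots> = (\<Sum>S\<in>Z. of_nat (count (image_mset Cliff (Sh \<xi> \<eta>)) S) * K n S M)"
        using that(2) by (intro sum_mset_eq_sum_count) (simp_all add: Z_def)
      finally show ?thesis .
    qed
    have "(\<Sum>S\<in>Z. of_nat (count Y S) * K n S M) = (\<Sum>S\<in>Z. of_nat (count Y' S) * K n S M)" for M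
      using sum_Sh[of \<alpha> \<beta> M] sum_Sh[of \<alpha>' \<beta>' M] sum_Sh_K_Cliff[OF dj(1), of M] sum_Sh_K_Cliff[OF dj(2), of M] eq
      by (simp add: Y_def Y'_def Z_def n_def)
    then have "(\<Sum>S\<in>Z. (of_nat (count Y S) - of_nat (count Y' S)) * K n S M) = 0" for M
      by (simp add: left_diff_distrib sum_subtractf)
    then have zero: "(\<Sum>(m, S)\<in>{n} \<times> Z. (of_nat (count Y S) - of_nat (count Y' S)) * K m S M) = 0" for M
      by (simp flip: sum.cartesian_product)
    have "sparse_set n S" if S: "S \<in> Z" for S
    proof -
      obtain \<gamma> where "\<gamma> \<in># Sh \<alpha> \<beta> \<or> \<gamma> \<in># Sh \<alpha>' \<beta>'" "S = Cliff \<gamma>"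
        using S by (auto simp: Z_def Y_def Y'_def)
      moreover from this have "length \<gamma> = n"
        using eq by (auto simp: n_def dest: length_Sh)
      ultimately show ?thesis
        using sparse_set_Cliff[of \<gamma>] by simp
    qed
    then have "of_nat (count Y S) - of_nat (count Y' S) = (0::rat)" if "S \<in> Z" for S
      using K_independent[OF _ _ zero, of n S] that by (auto simp: Z_def)
    then have "count Y S = count Y' S" for S
      by (cases "S \<in> Z") (auto simp: Z_def not_in_iff)
    then show ?thesis
      unfolding Y_def Y'_def by (rule multiset_eqI)
  qed
  moreover have "Cliff \<alpha> = Cliff \<beta>" if "pack \<alpha> = pack \<beta>" for \<alpha> \<beta>
    using that Cliff_pack by metis
  ultimately show ?thesis
    unfolding shuffle_compatible_on_words_def by blast
qed

section \<open>Transfer of algebra structures\<close>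

text \<open>Equational axioms hold in \<open>A\<close> because they hold after applying the
  injective \<open>h\<close>. With \<open>h = id\<close> this covers subalgebras.\<close>

lemma algebra_transfer:
  fixes R (structure) and A (structure) and B :: "('r, 'b) module" (structure)
  assumes B: "algebra R B"
    and h: "h \<in> carrier A \<rightarrow> carrier B" "inj_on h (carrier A)"
    and closed: "\<zero>\<^bsub>A\<^esub> \<in> carrier A" "\<one>\<^bsub>A\<^esub> \<in> carrier A"
      "\<And>x y. x \<in> carrier A \<Longrightarrow> y \<in> carrier A \<Longrightarrow> x \<oplus>\<^bsub>A\<^esub> y \<in> carrier A"
      "\<And>x y. x \<in> carrier A \<Longrightarrow> y \<in> carrier A \<Longrightarrow> x \<otimes>\<^bsub>A\<^esub> y \<in> carrier A"
      "\<And>c x. c \<in> carrier R \<Longrightarrow> x \<in> carrier A \<Longrightarrow> c \<odot>\<^bsub>A\<^esub> x \<in> carrier A"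
    and hom: "h \<zero>\<^bsub>A\<^esub> = \<zero>\<^bsub>B\<^esub>" "h \<one>\<^bsub>A\<^esub> = \<one>\<^bsub>B\<^esub>"
      "\<And>x y. x \<in> carrier A \<Longrightarrow> y \<in> carrier A \<Longrightarrow> h (x \<oplus>\<^bsub>A\<^esub> y) = h x \<oplus>\<^bsub>B\<^esub> h y"
      "\<And>x y. x \<in> carrier A \<Longrightarrow> y \<in> carrier A \<Longrightarrow> h (x \<otimes>\<^bsub>A\<^esub> y) = h x \<otimes>\<^bsub>B\<^esub> h y"
      "\<And>c x. c \<in> carrier R \<Longrightarrow> x \<in> carrier A \<Longrightarrow> h (c \<odot>\<^bsub>A\<^esub> x) = c \<odot>\<^bsub>B\<^esub> h x"
  shows "algebra R A"
proof -
  interpret B: algebra R B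
    by (rule B)
  have hB: "h x \<in> carrier B" if "x \<in> carrier A" for x
    using h(1) that by blast
  have eqI: "x = y" if "h x = h y" "x \<in> carrier A" "y \<in> carrier A" for x y
    using h(2) that by (rule inj_onD)
  show ?thesis
  proof (rule algebraI)
    show "cring R"
      by (rule B.R.is_cring)
    show "cring A"
    proof (rule cringI)
      show "abelian_group A"
      proof (rule abelian_groupI)
        fix x assume x: "x \<in> carrier A"
        \<comment> \<open>The additive inverse is the multiple by minus one, and \<open>A\<close> is
          closed under scaling.\<close>
        have "h ((\<ominus>\<^bsub>R\<^esub> \<one>\<^bsub>R\<^esub>) \<odot>\<^bsub>A\<^esub> x \<oplus>\<^bsub>A\<^esub> x) = h \<zero>\<^bsub>A\<^esub>"
          using x by (simp add: hom closed hB B.smult_l_minus B.M.l_neg)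
        then show "\<exists>y\<in>carrier A. y \<oplus>\<^bsub>A\<^esub> x = \<zero>\<^bsub>A\<^esub>"
          using x closed by (intro bexI[of _ "(\<ominus>\<^bsub>R\<^esub> \<one>\<^bsub>R\<^esub>) \<odot>\<^bsub>A\<^esub> x"] eqI) auto
      qed (auto intro!: eqI simp: hom closed hB B.M.a_ac)
      show "comm_monoid A"
        by (rule comm_monoidI) (auto intro!: eqI simp: hom closed hB B.m_ac)
    qed (auto intro!: eqI simp: hom closed hB B.l_distr)
  qed (auto intro!: eqI simp: hom closed hB B.smult_l_distr B.smult_r_distr B.smult_assoc1 B.smult_assoc2)
qed

section \<open>The algebra of all power series\<close>

lemma ps_mult_commute: "ps_mult f g = ps_mult g f"
proof
  fix M :: "nat multiset"
  have "M - (M - A) = A" if "A \<subseteq># M" for A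
    using that by (auto simp: multiset_eq_iff subseteq_mset_def)
  then show "ps_mult f g M = ps_mult g f M"
    unfolding ps_mult_def
    by (intro sum.reindex_bij_witness[where i = "\<lambda>A. M - A" and j = "\<lambda>A. M - A"]) simp_all
qed

lemma finite_submultisets: "finite {A. A \<subseteq># M}"
proof (rule finite_subset)
  show "{A. A \<subseteq># M} \<subseteq> (\<Union>n\<le>size M. multisets_of_size (set_mset M) n)"
    by (auto simp: multisets_of_size_def size_mset_mono dest: mset_subset_eqD)
qed (auto intro: finite_multisets_of_size)

lemma ps_mult_assoc: "ps_mult (ps_mult f g) h = ps_mult f (ps_mult g h)"
proof
  fix M
  have "ps_mult (ps_mult f g) h M =
      (\<Sum>(A, B)\<in>(SIGMA A:{A. A \<subseteq># M}. {B. B \<subseteq># A}). f B * g (A - B) * h (M - A))"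
    by (simp add: ps_mult_def sum_distrib_right sum.Sigma finite_submultisets)
  also have "\<dots> = (\<Sum>(B, C)\<in>(SIGMA B:{B. B \<subseteq># M}. {C. C \<subseteq># M - B}). f B * (g C * h (M - B - C)))"
    \<comment> \<open>Both sides run over the ordered decompositions of \<open>M\<close> into three
      multisets; \<open>(A, B)\<close> stands for the parts \<open>B\<close>, \<open>A - B\<close>,
      \<open>M - A\<close>.\<close>
    by (rule sum.reindex_bij_witness[where i = "\<lambda>(B, C). (B + C, B)" and j = "\<lambda>(A, B). (B, A - B)"])
      (auto simp: multiset_eq_iff subseteq_mset_def algebra_simps Nat.le_diff_conv2 intro: order_trans
        intro!: diff_le_mono)
  also have "\<dots> = ps_mult f (ps_mult g h) M"
    by (simp add: ps_mult_def sum_distrib_left sum.Sigma finite_submultisets)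
  finally show "ps_mult (ps_mult f g) h M = ps_mult f (ps_mult g h) M" .
qed

lemma ps_mult_one_left: "ps_mult ps_one f = f"
proof
  fix M
  have "ps_mult ps_one f M = (\<Sum>A | A \<subseteq># M. if A = {#} then f M else 0)"
    unfolding ps_mult_def by (intro sum.cong) (auto simp: ps_one_def)
  then show "ps_mult ps_one f M = f M"
    by (simp add: finite_submultisets)
qed

text \<open>The ambient algebra, with every power series in the carrier, into which both algebras of
  the theorem embed.\<close>

lemma algebra_power_series: "algebra rat_ring (QSym\<lparr>carrier := UNIV\<rparr>)" (is "algebra _ ?P")
proof (rule algebraI)
  show "cring (rat_ring)"
    by (rule cring_from_type_algebra)
  show "cring ?P"
  proof (rule cringI)
    show "abelian_group ?P"
    proof (rule abelian_groupI)
      show "\<exists>g\<in>carrier ?P. g \<oplus>\<^bsub>?P\<^esub> f = \<zero>\<^bsub>?P\<^esub>" for f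
        by (intro bexI[of _ "\<lambda>M. - f M"]) (auto simp: QSym_def)
    qed (auto simp: QSym_def)
    show "comm_monoid ?P"
      by (rule comm_monoidI) (auto simp: QSym_def ps_mult_assoc ps_mult_one_left intro: ps_mult_commute)
  qed (auto simp: QSym_def ps_mult_def distrib_right sum.distrib)
qed (auto simp: QSym_def ring_of_type_algebra_def ps_mult_def algebra_simps sum_distrib_left)

section \<open>The isomorphism\<close>

lemma Peak_eq_Cliff:
  assumes "distinct \<pi>"
  shows "Peak \<pi> = Cliff \<pi>"
proof -
  have "\<pi> ! (i - 2) \<noteq> \<pi> ! (i - 1)" if "2 \<le> i" "i \<le> length \<pi> - 1" for i
    using that nth_eq_iff_index_eq[OF assms, of "i - 2" "i - 1"] by auto
  then show ?thesis
    unfolding Peak_def Cliff_def by (intro Collect_cong) (use order_less_le in blast)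
qed

lemma ex_permutation_Peak:
  assumes "sparse_set n S"
  shows "\<exists>\<pi>\<in>permutation_words. length \<pi> = n \<and> Peak \<pi> = S"
proof
  \<comment> \<open>Letters at places in \<open>S\<close> are lifted above \<open>n\<close>. The
    neighbours of such a place are not lifted, so it becomes a peak; at any other inner place the
    next letter is larger.\<close>
  define v where "v p = (if p \<in> S then n + p else p)" for p
  define \<pi> where "\<pi> = map v [1..<Suc n]"
  have "inj_on v {1..n}"
    by (auto simp: inj_on_def v_def)
  then show "\<pi> \<in> permutation_words"
    by (auto simp: permutation_words_def words_def \<pi>_def distinct_map v_def atLeastLessThanSuc_atLeastAtMost
        simp del: upt_Suc)
  have len: "length \<pi> = n"
    by (simp add: \<pi>_def)
  have nth: "\<pi> ! i = v (Suc i)" if "i < n" for i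
    using that by (simp add: \<pi>_def del: upt_Suc)
  have "i \<in> Peak \<pi> \<longleftrightarrow> i \<in> S" if i: "2 \<le> i" "i < n" for i
  proof -
    obtain j where j: "i = Suc (Suc j)"
      using i by (metis add_2_eq_Suc le_Suc_ex)
    have "\<pi> ! (i - 2) = v (Suc j)" "\<pi> ! (i - 1) = v (Suc (Suc j))" "\<pi> ! i = v (Suc (Suc (Suc j)))"
      using i nth by (simp_all add: j)
    moreover have "i \<in> S \<Longrightarrow> Suc j \<notin> S" "i \<in> S \<Longrightarrow> Suc (Suc (Suc j)) \<notin> S"
      using assms by (auto simp: sparse_set_def j)
    ultimately show ?thesis
      using i len by (auto simp: Peak_def v_def j)
  qed
  moreover have "2 \<le> i \<and> i < n" if "i \<in> Peak \<pi> \<or> i \<in> S" for i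
    using that sparse_set_bounds[OF assms] len by (auto simp: Peak_def)
  ultimately show "length \<pi> = n \<and> Peak \<pi> = S"
    using len by blast
qed

lemma ex_permutation_wclass:
  assumes "C \<in> wclass Cliff ` words"
  shows "\<exists>\<pi>\<in>permutation_words. C = wclass Cliff \<pi>"
proof -
  obtain \<alpha> where "C = wclass Cliff \<alpha>"
    using assms by blast
  moreover obtain \<pi> where "\<pi> \<in> permutation_words" "length \<pi> = length \<alpha>" "Peak \<pi> = Cliff \<alpha>"
    using ex_permutation_Peak[OF sparse_set_Cliff] by blast
  ultimately show ?thesis
    by (auto simp: wclass_def permutation_words_def Peak_eq_Cliff)
qed

section \<open>The linear map from classes to peak functions\<close>

definition class_index :: "nat list set \<Rightarrow> nat \<times> nat set" where
  "class_index C = (let \<alpha> = SOME \<alpha>. \<alpha> \<in> C in (length \<alpha>, Cliff \<alpha>))"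

text \<open>All words of a class share length and cliff set, so the chosen representative does not
  matter.\<close>

lemma class_index_wclass:
  assumes "\<alpha> \<in> words"
  shows "class_index (wclass Cliff \<alpha>) = (length \<alpha>, Cliff \<alpha>)"
proof -
  have "\<alpha> \<in> wclass Cliff \<alpha>"
    using assms by (simp add: wclass_def)
  then have "(SOME \<alpha>'. \<alpha>' \<in> wclass Cliff \<alpha>) \<in> wclass Cliff \<alpha>"
    by (rule someI)
  then show ?thesis
    by (simp add: class_index_def wclass_def Let_def)
qed

definition peak_map :: "(nat list set \<Rightarrow>\<^sub>0 rat) \<Rightarrow> power_series" where
  "peak_map f M = (\<Sum>C\<in>Poly_Mapping.keys f. Poly_Mapping.lookup f C * case_prod K (class_index C) M)"

lemma peak_map_eq_sum:
  assumes "finite Y" "Poly_Mapping.keys f \<subseteq> Y"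
  shows "peak_map f M = (\<Sum>C\<in>Y. Poly_Mapping.lookup f C * case_prod K (class_index C) M)"
  unfolding peak_map_def using assms by (intro sum.mono_neutral_left) (auto simp: in_keys_iff)

lemma peak_map_zero: "peak_map 0 M = 0"
  by (simp add: peak_map_def)

lemma peak_map_add: "peak_map (f + g) M = peak_map f M + peak_map g M"
proof -
  let ?Y = "Poly_Mapping.keys f \<union> Poly_Mapping.keys g"
  have "Poly_Mapping.keys (f + g) \<subseteq> ?Y"
    by (rule Poly_Mapping.keys_add)
  then show ?thesis
    by (simp add: peak_map_eq_sum[of ?Y] lookup_add distrib_right sum.distrib)
qed

lemma lookup_scale: "Poly_Mapping.lookup (scale c f) C = c * Poly_Mapping.lookup f C"
  by (simp add: scale_def Poly_Mapping.map.rep_eq when_def)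

lemma keys_scale: "Poly_Mapping.keys (scale c f) \<subseteq> Poly_Mapping.keys f"
  by (auto simp: in_keys_iff lookup_scale)

lemma peak_map_scale: "peak_map (scale c f) M = c * peak_map f M"
  unfolding peak_map_eq_sum[OF finite_keys keys_scale]
  by (simp add: peak_map_def lookup_scale sum_distrib_left mult.assoc)

lemma peak_map_sum: "peak_map (\<Sum>i\<in>I. f i) M = (\<Sum>i\<in>I. peak_map (f i) M)"
  by (induction I rule: infinite_finite_induct) (simp_all add: peak_map_zero peak_map_add)

lemma peak_map_sum_mset: "peak_map (\<Sum>i\<in>#I. f i) M = (\<Sum>i\<in>#I. peak_map (f i) M)"
  by (induction I) (simp_all add: peak_map_zero peak_map_add)

lemma peak_map_basis_elem: "\<alpha> \<in> words \<Longrightarrow> peak_map (basis_elem Cliff \<alpha>) = K (length \<alpha>) (Cliff \<alpha>)"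
  by (rule ext) (simp add: peak_map_def basis_elem_def class_index_wclass)

text \<open>Once \<beta> is replaced by a representative disjoint from \<alpha>, the product of
  classes is the sum over shuffles, and \<open>sum_Sh_K_Cliff\<close> evaluates its image.\<close>

lemma class_mult_wclass:
  assumes "C \<in> wclass Cliff ` words" "D \<in> wclass Cliff ` words"
  shows "peak_map (class_mult Cliff C D) = ps_mult (case_prod K (class_index C)) (case_prod K (class_index D))"
    and "Poly_Mapping.keys (class_mult Cliff C D) \<subseteq> wclass Cliff ` words"
proof -
  obtain \<alpha> \<beta> where \<alpha>: "\<alpha> \<in> words" "C = wclass Cliff \<alpha>" and \<beta>: "\<beta> \<in> words" "D = wclass Cliff \<beta>"
    using assms by blast
  obtain \<beta>' where "\<beta>' \<in> wclass Cliff \<beta>" and dj: "disjoint_words \<alpha> \<beta>'"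
    using ex_disjoint_representative[OF shuffle_compatible_Cliff \<alpha>(1) \<beta>(1)] by blast
  then have \<beta>': "\<beta>' \<in> words" "D = wclass Cliff \<beta>'"
    using \<beta> by (auto simp: wclass_def)
  have eq: "class_mult Cliff C D = (\<Sum>\<gamma>\<in>#Sh \<alpha> \<beta>'. basis_elem Cliff \<gamma>)"
    using class_mult_eq[OF shuffle_compatible_Cliff \<alpha>(1) \<beta>'(1) dj] \<alpha> \<beta>' by simp
  have words: "\<gamma> \<in> words" if "\<gamma> \<in># Sh \<alpha> \<beta>'" for \<gamma>
    using Sh_words[OF \<alpha>(1) \<beta>'(1) that] .
  show "peak_map (class_mult Cliff C D) = ps_mult (case_prod K (class_index C)) (case_prod K (class_index D))"
  proof
    fix M
    have "peak_map (class_mult Cliff C D) M = (\<Sum>\<gamma>\<in>#Sh \<alpha> \<beta>'. K (length \<gamma>) (Cliff \<gamma>) M)"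
      unfolding eq peak_map_sum_mset using words
      by (intro arg_cong[where f = sum_mset] image_mset_cong) (simp add: peak_map_basis_elem)
    then show "peak_map (class_mult Cliff C D) M =
        ps_mult (case_prod K (class_index C)) (case_prod K (class_index D)) M"
      using \<alpha> \<beta>' by (simp add: sum_Sh_K_Cliff[OF dj] class_index_wclass)
  qed
  have "Poly_Mapping.keys (\<Sum>\<gamma>\<in>#G. basis_elem Cliff \<gamma>) \<subseteq> wclass Cliff ` words"
    if "\<And>\<gamma>. \<gamma> \<in># G \<Longrightarrow> \<gamma> \<in> words" for G
    using that
  proof (induction G)
    case (add \<gamma> G)
    then show ?case
      using Poly_Mapping.keys_add[of "basis_elem Cliff \<gamma>" "\<Sum>\<gamma>\<in>#G. basis_elem Cliff \<gamma>"]
      by (auto simp: basis_elem_def)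
  qed simp
  then show "Poly_Mapping.keys (class_mult Cliff C D) \<subseteq> wclass Cliff ` words"
    unfolding eq using words by blast
qed

section \<open>Multiplicativity, injectivity and image of the map\<close>

lemma carrier_word_algebra: "f \<in> carrier (word_algebra st) \<longleftrightarrow> Poly_Mapping.keys f \<subseteq> wclass st ` words"
  by (simp add: word_algebra_def)

lemma sum_in_carrier_word_algebra:
  assumes "\<And>i. i \<in> I \<Longrightarrow> f i \<in> carrier (word_algebra st)"
  shows "(\<Sum>i\<in>I. f i) \<in> carrier (word_algebra st)"
  using assms unfolding carrier_word_algebra
  by (intro order_trans[OF Poly_Mapping.keys_sum] UN_least)

lemma scale_in_carrier_word_algebra:
  "f \<in> carrier (word_algebra st) \<Longrightarrow> scale c f \<in> carrier (word_algebra st)"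
  using keys_scale[of c f] by (auto simp: carrier_word_algebra)

lemma basis_elem_in_carrier_word_algebra:
  "\<alpha> \<in> words \<Longrightarrow> basis_elem st \<alpha> \<in> carrier (word_algebra st)"
  by (auto simp: carrier_word_algebra basis_elem_def)

lemma peak_map_mult:
  assumes "f \<in> carrier (word_algebra Cliff)" "g \<in> carrier (word_algebra Cliff)"
  shows "peak_map (f \<otimes>\<^bsub>word_algebra Cliff\<^esub> g) = ps_mult (peak_map f) (peak_map g)"
proof
  fix M
  let ?k = "\<lambda>C. case_prod K (class_index C)"
  have "peak_map (f \<otimes>\<^bsub>word_algebra Cliff\<^esub> g) M =
      (\<Sum>C\<in>Poly_Mapping.keys f. \<Sum>D\<in>Poly_Mapping.keys g.
        Poly_Mapping.lookup f C * Poly_Mapping.lookup g D * ps_mult (?k C) (?k D) M)"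
    unfolding word_algebra_def monoid.simps peak_map_sum peak_map_scale using assms
    by (intro sum.cong refl) (auto simp: class_mult_wclass carrier_word_algebra subset_iff)
  also have "\<dots> = (\<Sum>C\<in>Poly_Mapping.keys f. \<Sum>D\<in>Poly_Mapping.keys g. \<Sum>A | A \<subseteq># M.
        (Poly_Mapping.lookup f C * ?k C A) * (Poly_Mapping.lookup g D * ?k D (M - A)))"
    by (simp only: ps_mult_def sum_distrib_left mult_ac)
  also have "\<dots> = (\<Sum>A | A \<subseteq># M. \<Sum>C\<in>Poly_Mapping.keys f. \<Sum>D\<in>Poly_Mapping.keys g.
        (Poly_Mapping.lookup f C * ?k C A) * (Poly_Mapping.lookup g D * ?k D (M - A)))"
    by (simp only: sum.swap[of _ "{A. A \<subseteq># M}" "Poly_Mapping.keys f"]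
        sum.swap[of _ "{A. A \<subseteq># M}" "Poly_Mapping.keys g"])
  also have "\<dots> = ps_mult (peak_map f) (peak_map g) M"
    by (simp only: ps_mult_def peak_map_def sum_product)
  finally show "peak_map (f \<otimes>\<^bsub>word_algebra Cliff\<^esub> g) M = ps_mult (peak_map f) (peak_map g) M" .
qed

lemma mult_in_carrier_word_algebra:
  assumes "f \<in> carrier (word_algebra Cliff)" "g \<in> carrier (word_algebra Cliff)"
  shows "f \<otimes>\<^bsub>word_algebra Cliff\<^esub> g \<in> carrier (word_algebra Cliff)"
proof -
  have "scale c (class_mult Cliff C D) \<in> carrier (word_algebra Cliff)"
    if "C \<in> Poly_Mapping.keys f" "D \<in> Poly_Mapping.keys g" for c C D
    using that assms class_mult_wclass(2)[of C D]
    by (intro scale_in_carrier_word_algebra) (auto simp: carrier_word_algebra)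
  then have "(\<Sum>C\<in>Poly_Mapping.keys f. \<Sum>D\<in>Poly_Mapping.keys g.
      scale (Poly_Mapping.lookup f C * Poly_Mapping.lookup g D) (class_mult Cliff C D))
      \<in> carrier (word_algebra Cliff)"
    by (intro sum_in_carrier_word_algebra)
  moreover have "f \<otimes>\<^bsub>word_algebra Cliff\<^esub> g = (\<Sum>C\<in>Poly_Mapping.keys f. \<Sum>D\<in>Poly_Mapping.keys g.
      scale (Poly_Mapping.lookup f C * Poly_Mapping.lookup g D) (class_mult Cliff C D))"
    by (simp add: word_algebra_def)
  ultimately show ?thesis
    by simp
qed

text \<open>Equal images give a linear relation among peak functions whose coefficients are the
  differences of those of \<open>f\<close> and \<open>g\<close>; distinct classes have distinct
  indices, so \<open>K_independent\<close> applies.\<close>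

lemma inj_on_peak_map: "inj_on peak_map (carrier (word_algebra Cliff))"
proof (rule inj_onI)
  fix f g
  assume f: "f \<in> carrier (word_algebra Cliff)" and g: "g \<in> carrier (word_algebra Cliff)"
    and eq: "peak_map f = peak_map g"
  define Y where "Y = Poly_Mapping.keys f \<union> Poly_Mapping.keys g"
  \<comment> \<open>This inverts \<open>class_index\<close> on classes of words.\<close>
  define cls where "cls n S = {\<beta> \<in> words. Cliff \<beta> = S \<and> length \<beta> = n}" for n S
  define c where "c n S = Poly_Mapping.lookup f (cls n S) - Poly_Mapping.lookup g (cls n S)" for n S
  have "finite Y"
    by (simp add: Y_def)
  have Y: "C \<in> wclass Cliff ` words" if "C \<in> Y" for C
    using that f g by (auto simp: Y_def carrier_word_algebra)
  have cls: "case_prod cls (class_index C) = C" if C: "C \<in> Y" for C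
  proof -
    obtain \<alpha> where "\<alpha> \<in> words" "C = wclass Cliff \<alpha>"
      using Y[OF C] by blast
    then have "case_prod cls (class_index C) = cls (length \<alpha>) (Cliff \<alpha>)"
      by (simp add: class_index_wclass)
    with \<open>C = wclass Cliff \<alpha>\<close> show ?thesis
      by (simp add: cls_def wclass_def)
  qed
  then have inj: "inj_on class_index Y"
    by (metis inj_on_inverseI)
  have zero: "(\<Sum>(n, S)\<in>class_index ` Y. c n S * K n S M) = 0" for M
  proof -
    have "(\<Sum>(n, S)\<in>class_index ` Y. c n S * K n S M) =
        (\<Sum>C\<in>Y. (Poly_Mapping.lookup f C - Poly_Mapping.lookup g C) * case_prod K (class_index C) M)"
      using cls by (auto simp: sum.reindex[OF inj] c_def case_prod_unfold intro!: sum.cong)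
    also have "\<dots> = peak_map f M - peak_map g M"
      using \<open>finite Y\<close> by (simp add: peak_map_eq_sum[of Y] Y_def left_diff_distrib sum_subtractf)
    finally show ?thesis
      by (simp add: eq)
  qed
  have sparse: "sparse_set n S" if "(n, S) \<in> class_index ` Y" for n S
    using that Y sparse_set_Cliff by (fastforce simp: class_index_wclass)
  have "Poly_Mapping.lookup f C = Poly_Mapping.lookup g C" if "C \<in> Y" for C
  proof -
    obtain n S where nS: "class_index C = (n, S)"
      by fastforce
    then have "c n S = 0"
      using \<open>finite Y\<close> that by (intro K_independent[OF _ sparse zero]) (auto simp: image_iff intro: sym)
    then show ?thesis
      using cls[OF that] nS by (simp add: c_def)
  qed
  moreover have "Poly_Mapping.lookup f C = Poly_Mapping.lookup g C" if "C \<notin> Y" for C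
    using that by (simp add: Y_def in_keys_iff)
  ultimately show "f = g"
    by (intro poly_mapping_eqI) blast
qed

text \<open>Every class contains a permutation, whose peak set is its cliff set, so classes and
  permutations give the same spanning functions.\<close>

lemma image_peak_map: "peak_map ` carrier (word_algebra Cliff) = carrier Peak_algebra"
proof (intro subset_antisym subsetI)
  fix F assume "F \<in> peak_map ` carrier (word_algebra Cliff)"
  then obtain f where F: "F = peak_map f" and f: "Poly_Mapping.keys f \<subseteq> wclass Cliff ` words"
    by (auto simp: carrier_word_algebra)
  have "\<forall>C\<in>Poly_Mapping.keys f. \<exists>\<pi>. \<pi> \<in> permutation_words \<and> C = wclass Cliff \<pi>"
    using f ex_permutation_wclass by blast
  then obtain p where p: "\<And>C. C \<in> Poly_Mapping.keys f \<Longrightarrow> p C \<in> permutation_words \<and> C = wclass Cliff (p C)"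
    by metis
  have inj: "inj_on p (Poly_Mapping.keys f)"
    using p by (metis inj_onI)
  have "peak_map f M = (\<Sum>\<pi>\<in>p ` Poly_Mapping.keys f.
      Poly_Mapping.lookup f (wclass Cliff \<pi>) * K (length \<pi>) (Peak \<pi>) M)" for M
    unfolding peak_map_def sum.reindex[OF inj] o_def
  proof (rule sum.cong[OF refl])
    fix C assume "C \<in> Poly_Mapping.keys f"
    from p[OF this] have C: "p C \<in> words" "distinct (p C)" "wclass Cliff (p C) = C"
      by (auto simp: permutation_words_def)
    then have "class_index C = (length (p C), Peak (p C))"
      using class_index_wclass[of "p C"] by (simp add: Peak_eq_Cliff)
    then show "Poly_Mapping.lookup f C * case_prod K (class_index C) M =
        Poly_Mapping.lookup f (wclass Cliff (p C)) * K (length (p C)) (Peak (p C)) M"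
      using C by simp
  qed
  then show "F \<in> carrier Peak_algebra"
    unfolding F Peak_algebra_def using p
    by (auto intro!: exI[of _ "p ` Poly_Mapping.keys f"] exI[of _ "\<lambda>\<pi>. Poly_Mapping.lookup f (wclass Cliff \<pi>)"])
next
  fix F assume "F \<in> carrier Peak_algebra"
  then obtain P c where P: "finite P" "P \<subseteq> permutation_words"
    and F: "F = (\<lambda>M. \<Sum>\<pi>\<in>P. c \<pi> * K (length \<pi>) (Peak \<pi>) M)"
    by (auto simp: Peak_algebra_def)
  have words: "\<pi> \<in> words" "distinct \<pi>" if "\<pi> \<in> P" for \<pi>
    using P that by (auto simp: permutation_words_def)
  \<comment> \<open>Several permutations in \<open>P\<close> may lie in one class; the sum adds
    their coefficients.\<close>
  have "F = peak_map (\<Sum>\<pi>\<in>P. scale (c \<pi>) (basis_elem Cliff \<pi>))"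
    unfolding F peak_map_sum[abs_def] peak_map_scale
    using words by (auto simp: peak_map_basis_elem Peak_eq_Cliff intro!: sum.cong)
  moreover have "(\<Sum>\<pi>\<in>P. scale (c \<pi>) (basis_elem Cliff \<pi>)) \<in> carrier (word_algebra Cliff)"
    using words
    by (intro sum_in_carrier_word_algebra scale_in_carrier_word_algebra basis_elem_in_carrier_word_algebra)
  ultimately show "F \<in> peak_map ` carrier (word_algebra Cliff)"
    by blast
qed

theorem corollary3p12:
  shows "shuffle_compatible_on_words Cliff \<and>
    (\<exists>\<Phi>. (\<forall>\<alpha>\<in>words. \<Phi> (basis_elem Cliff \<alpha>) = K (length \<alpha>) (Cliff \<alpha>)) \<and>
      algebra_iso rat_ring (word_algebra Cliff) Peak_algebra \<Phi>)"
proof -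
  let ?A = "word_algebra Cliff" and ?P = "QSym\<lparr>carrier := UNIV\<rparr>"
  have Nil: "[] \<in> words"
    by (simp add: words_def)
  have A_zero: "\<zero>\<^bsub>?A\<^esub> = 0" and A_one: "\<one>\<^bsub>?A\<^esub> = basis_elem Cliff []"
    and A_add: "f \<oplus>\<^bsub>?A\<^esub> g = f + g" and A_smult: "c \<odot>\<^bsub>?A\<^esub> f = scale c f" for c f g
    by (simp_all add: word_algebra_def)
  have B: "monoid.mult Peak_algebra = ps_mult" "\<one>\<^bsub>Peak_algebra\<^esub> = ps_one" "\<zero>\<^bsub>Peak_algebra\<^esub> = (\<lambda>M. 0)"
    "add Peak_algebra = (\<lambda>f g M. f M + g M)" "module.smult Peak_algebra = (\<lambda>c f M. c * f M)"
    by (simp_all add: Peak_algebra_def QSym_def)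
  have P: "monoid.mult ?P = ps_mult" "\<one>\<^bsub>?P\<^esub> = ps_one" "\<zero>\<^bsub>?P\<^esub> = (\<lambda>M. 0)" "carrier ?P = UNIV"
    "add ?P = (\<lambda>f g M. f M + g M)" "module.smult ?P = (\<lambda>c f M. c * f M)"
    by (simp_all add: QSym_def)
  have add: "peak_map (f + g) = (\<lambda>M. peak_map f M + peak_map g M)" for f g
    by (rule ext) (rule peak_map_add)
  have smult: "peak_map (scale c f) = (\<lambda>M. c * peak_map f M)" for c f
    by (rule ext) (rule peak_map_scale)
  have zero: "peak_map 0 = (\<lambda>M. 0)"
    by (rule ext) (rule peak_map_zero)
  have one: "peak_map (basis_elem Cliff []) = ps_one"
    by (rule ext) (simp add: peak_map_basis_elem[OF Nil] K_def)
  have closed: "0 \<in> carrier ?A" "basis_elem Cliff [] \<in> carrier ?A"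
    "f \<in> carrier ?A \<Longrightarrow> g \<in> carrier ?A \<Longrightarrow> f + g \<in> carrier ?A"
    for f g
    using Poly_Mapping.keys_add[of f g] basis_elem_in_carrier_word_algebra[OF Nil]
    by (auto simp: carrier_word_algebra)
  note closed = closed scale_in_carrier_word_algebra
  have algA: "algebra rat_ring ?A"
    by (rule algebra_transfer[OF algebra_power_series, where h = peak_map])
      (simp_all only: A_zero A_one A_add A_smult P closed mult_in_carrier_word_algebra peak_map_mult
        inj_on_peak_map add smult zero one Pi_UNIV UNIV_I)
  \<comment> \<open>Closure of the algebra of peaks comes from its being the image of
    \<open>peak_map\<close>; the axioms come from the ambient power series.\<close>
  have algB: "algebra rat_ring Peak_algebra"
  proof (rule algebra_transfer[OF algebra_power_series, where h = id])
    fix x y assume "x \<in> carrier Peak_algebra" "y \<in> carrier Peak_algebra"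
    then obtain f g where fg: "f \<in> carrier ?A" "g \<in> carrier ?A" "x = peak_map f" "y = peak_map g"
      unfolding image_peak_map[symmetric] by blast
    show "x \<oplus>\<^bsub>Peak_algebra\<^esub> y \<in> carrier Peak_algebra" "x \<otimes>\<^bsub>Peak_algebra\<^esub> y \<in> carrier Peak_algebra"
      unfolding B fg add[symmetric] peak_map_mult[OF fg(1,2), symmetric] image_peak_map[symmetric]
      by (intro imageI closed mult_in_carrier_word_algebra fg)+
  next
    fix c x assume "x \<in> carrier Peak_algebra"
    then obtain f where f: "f \<in> carrier ?A" "x = peak_map f"
      unfolding image_peak_map[symmetric] by blast
    show "c \<odot>\<^bsub>Peak_algebra\<^esub> x \<in> carrier Peak_algebra"
      unfolding B f smult[symmetric] image_peak_map[symmetric] by (intro imageI closed f)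
  next
    show "\<zero>\<^bsub>Peak_algebra\<^esub> \<in> carrier Peak_algebra" "\<one>\<^bsub>Peak_algebra\<^esub> \<in> carrier Peak_algebra"
      unfolding B zero[symmetric] one[symmetric] image_peak_map[symmetric] by (intro imageI closed)+
  qed (simp_all add: B P)
  have "peak_map \<in> ring_iso ?A Peak_algebra"
    unfolding ring_iso_def ring_hom_def bij_betw_def
    using inj_on_peak_map image_peak_map
    by (auto simp: A_one A_add B add one peak_map_mult)
  then have "algebra_iso rat_ring ?A Peak_algebra peak_map"
    unfolding algebra_iso_def using algA algB by (simp add: A_smult B smult)
  then show ?thesis
    using shuffle_compatible_Cliff peak_map_basis_elem by blast
qed

end
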